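(* For the random graph model described in the context, for any value of $M$ (the number of possible proof-of-work durations), letting time tend to infinity, the infinite directed acyclic graph $\mathcal{G}(\infty):=\lim_{n\to\infty}\mathcal{G}(t_n)$ exists almost surely in the metric space $(\mathcal{S}_*,d_* )$, it satisfies $\mathcal{G}(\infty)=\bigcup_{i=1}^{\infty}\mathcal{G}(t_i)$, and it is one-ended almost surely.
   Context: **Model.** Fix an integer $M\ge 1$, integers $0<h_1<\dots<h_M$, numbers $p_{\Theta,1},\dots,p_{\Theta,M}>0$ with $\sum_k p_{\Theta,k}=1$, a finite nonempty set $I_\epsilon$ of positive integers, and numbers $p_{\epsilon,j}>0$ ($j\in I_\epsilon$) with $\sum_j p_{\epsilon,j}=1$. Put $t_n:=n$; times and integers are identified. Vertices are labelled $0,1,2,\dots$; vertex $0$ is present at time $t_0$, and vertex $n\ge1$ arrives at time $t_n$. A pair $(i,j)$ denotes a directed edge from $i$ to $j$ ($j$ is then a parent of $i$). Each vertex $n\ge 1$ carries random variables $\Theta_n\in\{h_1,\dots,h_M\}$ (its proof-of-work duration), $\epsilon_n\in I_\epsilon$ (lag), and $X_n,Y_n$ (its two, possibly equal, parents). The directed graphs $\mathcal{G}(t_n)=(\mathcal{V}(t_n),\mathcal{E}(t_n))$ are defined by $\mathcal{V}(t_0)=\{0\}$, $\mathcal{E}(t_0)=\emptyset$, $$\mathcal{V}(t_{n+1})=\mathcal{V}(t_n)\cup\{k\ge1: t_k+\Theta_k=t_n\},\qquad \mathcal{E}(t_{n+1})=\mathcal{E}(t_n)\cup\{(k,X_k),(k,Y_k):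 k\ge 1,\ t_k+\Theta_k=t_n\},$$ and $\mathcal{G}(t_n):=\mathcal{G}(t_0)$ for $n<0$. The set of tips is $\mathcal{L}(t_n):=\{v\in\mathcal{V}(t_n): (i,v)\notin\mathcal{E}(t_n)\text{ for all }i\}$, and $L(t_n):=|\mathcal{L}(t_n)|$. Let $\Sigma_n$ be the $\sigma$-algebra generated by $\Theta_m,\epsilon_m,X_m,Y_m$, $1\le m\le n$. The law is determined by $$\mathbb{P}(\Theta_n=h_k,\epsilon_n=j,X_n=v,Y_n=v'\mid\Sigma_{n-1})=\frac{p_{\Theta,k}\,p_{\epsilon,j}}{L(t_n-j)^2}\,1_{\{v,v'\in\mathcal{L}(t_n-j)\}}$$ for $n\ge1$, $1\le k\le M$, $j\in I_\epsilon$ (so $(\Theta_n)$ and $(\epsilon_n)$ are i.i.d. and the two parents are chosen uniformly with replacement among the tips at time $t_n-\epsilon_n$). **Metric space.** $\mathcal{S}_*$ is the space of connected directed acyclic graphs (DAGs) rooted at vertex $0$ with all vertices having finite degree, and $d_*(\mathcal{G}_1,\mathcal{G}_2):=(r+1)^{-1}$, where $r$ is the biggest integer such that the two $r$-balls rooted at vertex $0$ in $\mathcal{G}_1$ and $\mathcal{G}_2$ are identical ($d_*=0$ if all balls agree). **One-endedness.** A ray in a directed graph is an infinite sequence of vertices $v_0,v_1,v_2,\dots$ in which either $(v_{i+1},v_i)$ is a directed edge for all $i\ge0$, or $(v_i,v_{i+1})$ is a directed edge for all $i\ge 0$. Two rays $r_1,r_2$ in a DAG are equivalent if there is a ray $r_3$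 (not necessarily distinct from $r_1,r_2$) that intersects $r_1$ and $r_2$ infinitely often. A DAG is one-ended if all its rays are equivalent. *)

theory Defs
  imports
    "HOL-Probability.Probability"
    "Graph_Theory.Digraph_Component"
begin

section \<open>The space of rooted locally finite connected DAGs\<close>

text \<open>Vertices are natural numbers and the root is always vertex \<open>0\<close>. Connectedness and
  distances refer to the underlying undirected graph, \<open>mk_symmetric G\<close>.\<close>

type_synonym dag = "nat pair_pre_digraph"

definition dag_space :: "dag set" where
  "dag_space = {G :: dag. pair_wf_digraph G \<and> 0 \<in> pverts G \<and> Digraph_Component.connected (with_proj G) \<and> acyclic (parcs G) \<and>
     (\<forall>v\<in>pverts G. finite (in_arcs G v) \<and> finite (out_arcs G v))}"

definition ball_verts :: "nat \<Rightarrow> dag \<Rightarrow> nat set" where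
  "ball_verts r G = {v. \<exists>p. pre_digraph.awalk (mk_symmetric G) 0 p v \<and> length p \<le> r}"

definition root_ball :: "nat \<Rightarrow> dag \<Rightarrow> (nat, nat \<times> nat) pre_digraph" where
  "root_ball r G = with_proj G \<restriction> ball_verts r G"

text \<open>On \<^const>\<open>dag_space\<close> the balls of radius \<open>0\<close> always agree, and agreement of the balls of
  radius \<open>r\<close> implies agreement of all smaller ones, so the greatest \<open>r\<close> below exists.\<close>

definition dag_dist :: "dag \<Rightarrow> dag \<Rightarrow> real" where
  "dag_dist G H = (if \<forall>r. root_ball r G = root_ball r H then 0
     else inverse (real (GREATEST r. root_ball r G = root_ball r H) + 1))"

lemma ball_verts_0: "ball_verts 0 G = {0} \<inter> pverts G"
  by (auto simp: ball_verts_def pre_digraph.awalk_def pcas.simps cas_with_proj_eq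
      awalk_verts_with_proj_eq)

lemma ball_verts_mono: "r \<le> s \<Longrightarrow> ball_verts r G \<subseteq> ball_verts s G"
  unfolding ball_verts_def using order_trans by blast

lemma ball_verts_subset:
  assumes "pair_wf_digraph G" shows "ball_verts r G \<subseteq> pverts G"
proof -
  interpret S: pair_wf_digraph "mk_symmetric G"
    using assms by (intro wf_digraph.wellformed_mk_symmetric) (simp add: wf_digraph_wp_iff)
  show ?thesis
    by (auto simp: ball_verts_def dest: S.awalk_last_in_verts)
qed

lemma ball_verts_Suc:
  assumes "pair_wf_digraph G"
  shows "ball_verts (Suc r) G = ball_verts r G \<union> {v. \<exists>u\<in>ball_verts r G. (u, v) \<in> parcs (mk_symmetric G)}"
proof -
  interpret S: pair_wf_digraph "mk_symmetric G"
    using assms by (intro wf_digraph.wellformed_mk_symmetric) (simp add: wf_digraph_wp_iff)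
  show ?thesis
  proof (intro set_eqI iffI)
    fix v assume "v \<in> ball_verts (Suc r) G"
    then obtain p where p: "S.awalk 0 p v" "length p \<le> Suc r"
      by (auto simp: ball_verts_def)
    show "v \<in> ball_verts r G \<union> {v. \<exists>u\<in>ball_verts r G. (u, v) \<in> parcs (mk_symmetric G)}"
    proof (cases p rule: rev_cases)
      case Nil
      then show ?thesis using p by (auto simp: ball_verts_def intro: exI[of _ "[]"])
    next
      case (snoc q e)
      then have "S.awalk 0 q (fst e)" "e \<in> parcs (mk_symmetric G)" "snd e = v" "length q \<le> r"
        using p by (auto simp: S.awalk_simps)
      then have "fst e \<in> ball_verts r G" "(fst e, v) \<in> parcs (mk_symmetric G)"
        by (auto simp: ball_verts_def)
      then show ?thesis by blast
    qed
  next
    fix v assume "v \<in> ball_verts r G \<union> {v. \<exists>u\<in>ball_verts r G. (u, v) \<in> parcs (mk_symmetric G)}"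
    then show "v \<in> ball_verts (Suc r) G"
    proof
      assume "v \<in> ball_verts r G"
      then show ?thesis using ball_verts_mono[of r "Suc r" G] by auto
    next
      assume "v \<in> {v. \<exists>u\<in>ball_verts r G. (u, v) \<in> parcs (mk_symmetric G)}"
      then obtain u p where u: "(u, v) \<in> parcs (mk_symmetric G)" "S.awalk 0 p u" "length p \<le> r"
        by (auto simp: ball_verts_def)
      then have "S.awalk u [(u, v)] v"
        using S.wellformed'(2) by (auto simp: S.awalk_simps)
      then have "S.awalk 0 (p @ [(u, v)]) v"
        using u(2) by (rule S.awalk_appendI[rotated])
      moreover have "length (p @ [(u, v)]) \<le> Suc r" using u(3) by simp
      ultimately show ?thesis unfolding ball_verts_def by blast
    qed
  qed
qed

lemma root_ball_eq_iff:
  "root_ball r G = root_ball r H \<longleftrightarrow> ball_verts r G = ball_verts r H \<and>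
     Restr (parcs G) (ball_verts r G) = Restr (parcs H) (ball_verts r H)"
proof -
  have *: "{e \<in> E. fst e \<in> A \<and> snd e \<in> A} = Restr E A" for E :: "nat rel" and A by auto
  show ?thesis by (simp add: root_ball_def induce_subgraph_def *)
qed

lemma root_ball_antimono:
  assumes "G \<in> dag_space" "H \<in> dag_space" and eq: "root_ball s G = root_ball s H" and "r \<le> s"
  shows "root_ball r G = root_ball r H"
proof -
  have wf: "pair_wf_digraph G" "pair_wf_digraph H" and root: "0 \<in> pverts G" "0 \<in> pverts H"
    using assms by (auto simp: dag_space_def)
  have sym_iff: "(u, v) \<in> parcs (mk_symmetric K) \<longleftrightarrow> (u, v) \<in> parcs K \<or> (v, u) \<in> parcs K" for u v and K :: dag
    unfolding parcs_mk_symmetric with_proj_simps UN_iff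
    by (auto intro: bexI[of _ "(u, v)"] bexI[of _ "(v, u)"])
  have step: "ball_verts (Suc q) A \<subseteq> ball_verts (Suc q) B"
    if wfA: "pair_wf_digraph A" and that': "pair_wf_digraph B" "root_ball s A = root_ball s B"
      "Suc q \<le> s" "ball_verts q A = ball_verts q B" for q and A B :: dag
  proof
    fix v assume v: "v \<in> ball_verts (Suc q) A"
    show "v \<in> ball_verts (Suc q) B"
    proof (cases "v \<in> ball_verts q A")
      case False
      then obtain u where u: "u \<in> ball_verts q A" "(u, v) \<in> parcs (mk_symmetric A)"
        using v ball_verts_Suc[OF wfA] by auto
      have "v \<in> ball_verts s A" "u \<in> ball_verts s A"
        using v u(1) that'(3) ball_verts_mono[of "Suc q" s A] ball_verts_mono[of q s A] by auto
      then have "(u, v) \<in> parcs (mk_symmetric B)"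
        using u(2) that'(2) unfolding root_ball_eq_iff sym_iff by blast
      then show ?thesis using u(1) that'(4) ball_verts_Suc[OF that'(1)] by auto
    qed (use that' ball_verts_Suc[OF that'(1)] in auto)
  qed
  have "ball_verts r G = ball_verts r H"
    using \<open>r \<le> s\<close>
  proof (induction r)
    case 0
    then show ?case using root by (simp add: ball_verts_0)
  next
    case (Suc r)
    then show ?case
      using step[OF wf eq] step[OF wf(2,1) eq[symmetric]] by (simp add: subset_antisym)
  qed
  then show ?thesis
    using eq ball_verts_mono[OF \<open>r \<le> s\<close>, of G] unfolding root_ball_eq_iff by blast
qed

lemma root_ball_0:
  assumes "G \<in> dag_space" "H \<in> dag_space"
  shows "root_ball 0 G = root_ball 0 H"
proof -
  have "(0, 0) \<notin> parcs K" if "K \<in> dag_space" for K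
    using that by (auto simp: dag_space_def acyclic_def)
  moreover have "0 \<in> pverts G" "0 \<in> pverts H" using assms by (auto simp: dag_space_def)
  ultimately show ?thesis using assms by (auto simp: root_ball_eq_iff ball_verts_0)
qed

lemma dag_eqI:
  assumes GH: "G \<in> dag_space" "H \<in> dag_space" and eq: "\<And>r. root_ball r G = root_ball r H"
  shows "G = H"
proof -
  have un: "pverts K = (\<Union>r. ball_verts r K)" if "K \<in> dag_space" for K
  proof
    have wf: "pair_wf_digraph K" using that by (simp add: dag_space_def)
    then show "(\<Union>r. ball_verts r K) \<subseteq> pverts K" using ball_verts_subset by blast
    interpret S: pair_wf_digraph "mk_symmetric K"
      using wf by (intro wf_digraph.wellformed_mk_symmetric) (simp add: wf_digraph_wp_iff)
    show "pverts K \<subseteq> (\<Union>r. ball_verts r K)"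
    proof
      fix v assume "v \<in> pverts K"
      then have "0 \<rightarrow>\<^sup>*\<^bsub>mk_symmetric K\<^esub> v"
        using that by (auto simp: dag_space_def connected_def strongly_connected_def)
      then show "v \<in> (\<Union>r. ball_verts r K)"
        unfolding S.reachable_awalk by (auto simp: ball_verts_def)
    qed
  qed
  have V: "pverts G = pverts H"
    using eq un[OF GH(1)] un[OF GH(2)] by (simp add: root_ball_eq_iff)
  have sub: "parcs A \<subseteq> parcs B"
    if A: "A \<in> dag_space" and AB: "\<And>r. root_ball r A = root_ball r B" for A B
  proof
    fix e assume e: "e \<in> parcs A"
    have "pair_wf_digraph A" using A by (simp add: dag_space_def)
    then have "fst e \<in> pverts A" "snd e \<in> pverts A"
      using e by (auto dest: pair_wf_digraph.arc_fst_in_verts pair_wf_digraph.arc_snd_in_verts)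
    then obtain r s where "fst e \<in> ball_verts r A" "snd e \<in> ball_verts s A"
      using un[OF A] by auto
    then have "fst e \<in> ball_verts (max r s) A" "snd e \<in> ball_verts (max r s) A"
      using ball_verts_mono[of r "max r s" A] ball_verts_mono[of s "max r s" A] by auto
    then have "e \<in> Restr (parcs A) (ball_verts (max r s) A)" using e by (cases e) auto
    then show "e \<in> parcs B" using AB[of "max r s"] unfolding root_ball_eq_iff by blast
  qed
  have "parcs G = parcs H" using sub[OF GH(1)] sub[OF GH(2)] eq by (metis subset_antisym)
  then show ?thesis using V by simp
qed

lemma dag_dist_le_iff:
  assumes GH: "G \<in> dag_space" "H \<in> dag_space"
  shows "dag_dist G H \<le> inverse (real r + 1) \<longleftrightarrow> root_ball r G = root_ball r H"
proof (cases "\<forall>r. root_ball r G = root_ball r H")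
  case True
  then show ?thesis by (simp add: dag_dist_def)
next
  case False
  define N where "N = (GREATEST r. root_ball r G = root_ball r H)"
  from False obtain b where b: "root_ball b G \<noteq> root_ball b H" by auto
  have bd: "\<forall>r. root_ball r G = root_ball r H \<longrightarrow> r \<le> b"
    using b root_ball_antimono[OF GH] by (meson nle_le)
  have N: "root_ball N G = root_ball N H"
    unfolding N_def using GreatestI_nat[of "\<lambda>r. root_ball r G = root_ball r H" 0 b]
      root_ball_0[OF GH] bd by simp
  have "root_ball r G = root_ball r H \<longleftrightarrow> r \<le> N"
  proof
    show "r \<le> N" if "root_ball r G = root_ball r H"
      unfolding N_def using that bd by (intro Greatest_le_nat[where b = b]) auto
  qed (use N root_ball_antimono[OF GH] in blast)
  moreover have "dag_dist G H = inverse (real N + 1)"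
    using False by (simp add: dag_dist_def N_def)
  ultimately show ?thesis by simp
qed

interpretation dag_metric: Metric_space dag_space dag_dist
proof
  show "0 \<le> dag_dist G H" for G H by (simp add: dag_dist_def)
  show "dag_dist G H = dag_dist H G" for G H
  proof -
    have "(\<lambda>r. root_ball r G = root_ball r H) = (\<lambda>r. root_ball r H = root_ball r G)"
      by (intro ext) (rule eq_commute)
    then show ?thesis unfolding dag_dist_def by metis
  qed
  show "dag_dist G H = 0 \<longleftrightarrow> G = H" if "G \<in> dag_space" "H \<in> dag_space" for G H
  proof
    assume "dag_dist G H = 0"
    then have "root_ball r G = root_ball r H" for r
      using dag_dist_le_iff[OF that, of r] by simp
    then show "G = H" by (rule dag_eqI[OF that])
  qed (simp add: dag_dist_def)
  show "dag_dist G K \<le> dag_dist G H + dag_dist H K"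
    if S: "G \<in> dag_space" "H \<in> dag_space" "K \<in> dag_space" for G H K
  proof (rule ccontr)
    assume less: "\<not> ?thesis"
    have nonneg: "0 \<le> dag_dist A B" for A B by (simp add: dag_dist_def)
    have dist_less: "root_ball (Suc N) A = root_ball (Suc N) B"
      if "A \<in> dag_space" "B \<in> dag_space" "dag_dist A B < inverse (real N + 1)" for A B N
    proof (cases "\<forall>r. root_ball r A = root_ball r B")
      case False
      define M where "M = (GREATEST r. root_ball r A = root_ball r B)"
      have d: "dag_dist A B = inverse (real M + 1)" using False by (simp add: dag_dist_def M_def)
      then have "Suc N \<le> M" using that(3) by simp
      then have "dag_dist A B \<le> inverse (real (Suc N) + 1)" unfolding d by simp
      then show ?thesis using dag_dist_le_iff[OF that(1,2)] by blast
    qed auto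
    from less nonneg[of G H] nonneg[of H K] have "dag_dist G K \<noteq> 0" by linarith
    then obtain N where N: "dag_dist G K = inverse (real N + 1)"
      by (cases "\<forall>r. root_ball r G = root_ball r K") (auto simp: dag_dist_def)
    then have "dag_dist G H < inverse (real N + 1)" "dag_dist H K < inverse (real N + 1)"
      using less nonneg[of G H] nonneg[of H K] by linarith+
    then have "root_ball (Suc N) G = root_ball (Suc N) K" using dist_less[OF S(1,2)] dist_less[OF S(2,3)] by simp
    then have "inverse (real N + 1) \<le> inverse (real (Suc N) + 1)"
      using dag_dist_le_iff[OF S(1,3), of "Suc N"] N by simp
    then show False by simp
  qed
qed


section \<open>Rays and one-endedness\<close>

definition ray :: "dag \<Rightarrow> (nat \<Rightarrow> nat) \<Rightarrow> bool" where
  "ray G v \<longleftrightarrow> (\<forall>i. (v (Suc i), v i) \<in> parcs G) \<or> (\<forall>i. (v i, v (Suc i)) \<in> parcs G)"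

definition ray_equiv :: "dag \<Rightarrow> (nat \<Rightarrow> nat) \<Rightarrow> (nat \<Rightarrow> nat) \<Rightarrow> bool" where
  "ray_equiv G r1 r2 \<longleftrightarrow>
     (\<exists>r3. ray G r3 \<and> infinite (range r3 \<inter> range r1) \<and> infinite (range r3 \<inter> range r2))"

definition one_ended :: "dag \<Rightarrow> bool" where
  "one_ended G \<longleftrightarrow> (\<forall>r1 r2. ray G r1 \<longrightarrow> ray G r2 \<longrightarrow> ray_equiv G r1 r2)"


section \<open>The random graph process\<close>

definition tips :: "dag \<Rightarrow> nat set" where
  "tips G = {v \<in> pverts G. \<forall>i. (i, v) \<notin> parcs G}"

primrec tangle_nat ::
  "(nat \<Rightarrow> 'o \<Rightarrow> nat) \<Rightarrow> (nat \<Rightarrow> 'o \<Rightarrow> nat) \<Rightarrow> (nat \<Rightarrow> 'o \<Rightarrow> nat) \<Rightarrow> 'o \<Rightarrow> nat \<Rightarrow> dag" where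
  "tangle_nat \<Theta> X Y \<omega> 0 = \<lparr>pverts = {0}, parcs = {}\<rparr>"
| "tangle_nat \<Theta> X Y \<omega> (Suc n) =
    \<lparr>pverts = pverts (tangle_nat \<Theta> X Y \<omega> n) \<union> {k. k \<ge> 1 \<and> k + \<Theta> k \<omega> = n},
     parcs = parcs (tangle_nat \<Theta> X Y \<omega> n) \<union>
       (\<Union>k\<in>{k. k \<ge> 1 \<and> k + \<Theta> k \<omega> = n}. {(k, X k \<omega>), (k, Y k \<omega>)})\<rparr>"

text \<open>Times are integers, with the graph at time \<open>0\<close> used at all negative times.\<close>

definition tangle ::
  "(nat \<Rightarrow> 'o \<Rightarrow> nat) \<Rightarrow> (nat \<Rightarrow> 'o \<Rightarrow> nat) \<Rightarrow> (nat \<Rightarrow> 'o \<Rightarrow> nat) \<Rightarrow> 'o \<Rightarrow> int \<Rightarrow> dag" where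
  "tangle \<Theta> X Y \<omega> t = (if t < 0 then tangle_nat \<Theta> X Y \<omega> 0 else tangle_nat \<Theta> X Y \<omega> (nat t))"

definition tangle_union ::
  "(nat \<Rightarrow> 'o \<Rightarrow> nat) \<Rightarrow> (nat \<Rightarrow> 'o \<Rightarrow> nat) \<Rightarrow> (nat \<Rightarrow> 'o \<Rightarrow> nat) \<Rightarrow> 'o \<Rightarrow> dag" where
  "tangle_union \<Theta> X Y \<omega> =
    \<lparr>pverts = (\<Union>i\<in>{1::nat..}. pverts (tangle \<Theta> X Y \<omega> (int i))),
     parcs = (\<Union>i\<in>{1::nat..}. parcs (tangle \<Theta> X Y \<omega> (int i)))\<rparr>"

definition past_algebra ::
  "'o measure \<Rightarrow> (nat \<Rightarrow> 'o \<Rightarrow> nat) set \<Rightarrow> nat \<Rightarrow> 'o measure" where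
  "past_algebra P \<Z> n = sigma (space P) {Z m -` A \<inter> space P |Z m A. Z \<in> \<Z> \<and> m \<in> {1..n}}"

locale tangle_model = prob_space P for P :: "'o measure" +
  fixes M :: nat and h :: "nat \<Rightarrow> nat" and p\<^sub>\<Theta> :: "nat \<Rightarrow> real"
    and I :: "nat set" and p\<^sub>\<epsilon> :: "nat \<Rightarrow> real"
    and \<Theta> \<epsilon> X Y :: "nat \<Rightarrow> 'o \<Rightarrow> nat"
  assumes M_ge_1: "M \<ge> 1"
    and h_1_pos: "0 < h 1"
    and h_strict_mono: "strict_mono_on {1..M} h"
    and p\<^sub>\<Theta>_pos: "\<And>k. k \<in> {1..M} \<Longrightarrow> p\<^sub>\<Theta> k > 0"
    and p\<^sub>\<Theta>_sum: "(\<Sum>k\<in>{1..M}. p\<^sub>\<Theta> k) = 1"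
    and I_finite: "finite I"
    and I_nonempty: "I \<noteq> {}"
    and I_pos: "\<And>j. j \<in> I \<Longrightarrow> j > 0"
    and p\<^sub>\<epsilon>_pos: "\<And>j. j \<in> I \<Longrightarrow> p\<^sub>\<epsilon> j > 0"
    and p\<^sub>\<epsilon>_sum: "(\<Sum>j\<in>I. p\<^sub>\<epsilon> j) = 1"
    and random_variables: "\<And>n Z. n \<ge> 1 \<Longrightarrow> Z \<in> {\<Theta>, \<epsilon>, X, Y} \<Longrightarrow> random_variable (count_space UNIV) (Z n)"
    and \<Theta>_range: "\<And>n \<omega>. n \<ge> 1 \<Longrightarrow> \<omega> \<in> space P \<Longrightarrow> \<Theta> n \<omega> \<in> h ` {1..M}"
    and \<epsilon>_range: "\<And>n \<omega>. n \<ge> 1 \<Longrightarrow> \<omega> \<in> space P \<Longrightarrow> \<epsilon> n \<omega> \<in> I"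
    and conditional_law: "\<And>n k j v v'. n \<ge> 1 \<Longrightarrow> k \<in> {1..M} \<Longrightarrow> j \<in> I \<Longrightarrow>
      AE \<omega> in P. real_cond_exp P (past_algebra P {\<Theta>, \<epsilon>, X, Y} (n - 1))
          (indicator {\<omega> \<in> space P. \<Theta> n \<omega> = h k \<and> \<epsilon> n \<omega> = j \<and> X n \<omega> = v \<and> Y n \<omega> = v'}) \<omega> =
        (let T = tips (tangle \<Theta> X Y \<omega> (int n - int j))
         in p\<^sub>\<Theta> k * p\<^sub>\<epsilon> j / (real (card T))\<^sup>2 * of_bool (v \<in> T \<and> v' \<in> T))"

end

theory Submission
  imports Defs
begin

text \<open>
Fix a vertex \<open>u\<close> and call a step good if the new vertex has a descendant of u as its first parent and the
oldest available tip as its second. In a long enough run of good steps every new vertex descends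
from u and all tips that are older than the run disappear, so from then on all vertices descend from u.
Such a run occurs almost surely: as long as it has not occurred, the number of unselected vertices minus
a reward that grows with the length of the current run has drift at most -1/2. Indeed, when there are many
unselected vertices, a new vertex typically selects two of them and adds only itself; when there
are few, a good step has probability bounded below.

Hence almost surely each vertex u is an ancestor of all but finitely many vertices. Then u has a child, so it
stops being a tip and has finite degree, which gives the limit; and every ray
meets the descendants of u, so a path can alternate between two given rays.
\<close>

section \<open>Deterministic histories\<close>

text \<open>The obstacle is the delay: the tips offered to a new vertex date from an earlier time,
  and their number has no simple one-step recursion. The number of \<open>free\<close> vertices
  ignores delays, grows by at most one per step, and stays within a constant of every visible tip
  count, because only the last \<open>H + J\<close> vertices can be hidden. Its downward drift fails
  when it is small; the reward for a run repairs exactly this, so that both regimes obey one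
  inequality. No Markov chain or return-time argument is then needed: a non-negative quantity cannot
  lose a fixed amount per step forever. A good step restricts the two parents only, so the drift
  bound holds for each duration and each lag separately. The constants therefore depend on the
  largest duration and lag, but not on \<open>M\<close> or on any probability. Choosing the oldest
  tip has two merits: it is one determined vertex, so a good pair has conditional probability at
  least one over the squared number of tips, and it lets no old tip survive a long run. All
  estimates concern one fixed \<open>u\<close>; countability of the vertices gives all
  \<open>u\<close> at once.\<close>

type_synonym history = "nat \<Rightarrow> nat \<times> nat \<times> nat \<times> nat"

abbreviation dur :: "history \<Rightarrow> nat \<Rightarrow> nat" where "dur s k \<equiv> fst (s k)"
abbreviation lag :: "history \<Rightarrow> nat \<Rightarrow> nat" where "lag s k \<equiv> fst (snd (s k))"
abbreviation par1 :: "history \<Rightarrow> nat \<Rightarrow> nat" where "par1 s k \<equiv> fst (snd (snd (s k)))"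
abbreviation par2 :: "history \<Rightarrow> nat \<Rightarrow> nat" where "par2 s k \<equiv> snd (snd (snd (s k)))"

text \<open>The strict inequality is the one-step delay in the graph recursion. As
  \<open>landed s 0 = {0}\<close>, truncated subtraction in \<open>k - lag s k\<close> reproduces
  the convention for negative times.\<close>

definition landed :: "history \<Rightarrow> nat \<Rightarrow> nat set" where
  "landed s t = insert 0 {k. 1 \<le> k \<and> k + dur s k < t}"

definition tip_set :: "history \<Rightarrow> nat \<Rightarrow> nat set" where
  "tip_set s t = {v \<in> landed s t. \<forall>k\<ge>1. k + dur s k < t \<longrightarrow> par1 s k \<noteq> v \<and> par2 s k \<noteq> v}"

text \<open>Vertices count before they land, and selections count before their arcs are
  visible.\<close>

definition free :: "history \<Rightarrow> nat \<Rightarrow> nat set" where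
  "free s n = {v. v \<le> n \<and> (\<forall>k\<in>{1..n}. par1 s k \<noteq> v \<and> par2 s k \<noteq> v)}"

text \<open>The side conditions make membership of \<open>k\<close> depend on the history up to \<open>k\<close> only, even for
  histories in which parents are not older than their children.\<close>
inductive_set desc :: "history \<Rightarrow> nat \<Rightarrow> nat set" for s u where
  self: "u \<in> desc s u"
| par1: "par1 s k \<in> desc s u \<Longrightarrow> par1 s k < k \<Longrightarrow> k \<in> desc s u"
| par2: "par2 s k \<in> desc s u \<Longrightarrow> par2 s k < k \<Longrightarrow> k \<in> desc s u"

lemma finite_landed [simp]: "finite (landed s t)"
  by (rule finite_subset[of _ "{..t}"]) (auto simp: landed_def)

lemma finite_tip_set [simp]: "finite (tip_set s t)"
  by (rule finite_subset[of _ "landed s t"]) (auto simp: tip_set_def)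

lemma finite_free [simp]: "finite (free s n)"
  by (rule finite_subset[of _ "{..n}"]) (auto simp: free_def)

lemma card_free_le: "card (free s n) \<le> Suc n"
proof -
  have "card (free s n) \<le> card {..n}" by (rule card_mono) (auto simp: free_def)
  then show ?thesis by simp
qed

lemma tip_set_less: "v \<in> tip_set s t \<Longrightarrow> t \<le> n \<Longrightarrow> 0 < n \<Longrightarrow> v < n"
  by (auto simp: tip_set_def landed_def)

lemma free_Suc_subset:
  "free s (Suc n) \<subseteq> insert (Suc n) (free s n - {par1 s (Suc n), par2 s (Suc n)})"
proof
  fix v assume v: "v \<in> free s (Suc n)"
  then have "par1 s k \<noteq> v \<and> par2 s k \<noteq> v" if "k \<in> {1..Suc n}" for k
    using that unfolding free_def by blast
  then show "v \<in> insert (Suc n) (free s n - {par1 s (Suc n), par2 s (Suc n)})"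
    using v by (auto simp: free_def le_Suc_eq)
qed

lemma card_free_Suc: "card (free s (Suc n)) \<le> Suc (card (free s n))"
proof -
  have "card (free s (Suc n)) \<le> card (insert (Suc n) (free s n))"
    by (rule card_mono) (use free_Suc_subset[of s n] in auto)
  also have "\<dots> \<le> Suc (card (free s n))" by (simp add: card_insert_if)
  finally show ?thesis .
qed

text \<open>\<open>k + dur s k < t\<close> and \<open>t \<le> Suc n\<close> force
  \<open>k \<le> n\<close>. The congruence lemmas serve twice: to overwrite entry
  \<open>Suc n\<close> by a hypothetical outcome, and to prove measurability with respect to the
  past.\<close>

lemma landed_cong: "\<forall>k\<in>{1..n}. s k = s' k \<Longrightarrow> t \<le> Suc n \<Longrightarrow> landed s t = landed s' t"
  unfolding landed_def by (intro arg_cong[where f = "insert 0"] Collect_cong) force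

lemma tip_set_cong:
  assumes "\<forall>k\<in>{1..n}. s k = s' k" "t \<le> Suc n"
  shows "tip_set s t = tip_set s' t"
proof -
  have "1 \<le> k \<and> k + dur r k < t \<Longrightarrow> s k = s' k" for k r using assms by auto
  then have "(1 \<le> k \<and> k + dur s k < t \<longrightarrow> par1 s k \<noteq> v \<and> par2 s k \<noteq> v) \<longleftrightarrow>
     (1 \<le> k \<and> k + dur s' k < t \<longrightarrow> par1 s' k \<noteq> v \<and> par2 s' k \<noteq> v)" for k v
    by metis
  then show ?thesis unfolding tip_set_def landed_cong[OF assms] by blast
qed

lemma free_cong: "\<forall>k\<in>{1..n}. s k = s' k \<Longrightarrow> free s n = free s' n"
  by (auto simp: free_def)

lemma desc_cong_imp:
  assumes "m \<in> desc s u" "\<forall>k\<in>{1..n}. s k = s' k" "m \<le> n"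
  shows "m \<in> desc s' u"
  using assms(1,3)
proof induction
  case (par1 k)
  then have "s k = s' k" using assms(2) by simp
  with par1 show ?case by (auto intro: desc.par1)
next
  case (par2 k)
  then have "s k = s' k" using assms(2) by simp
  with par2 show ?case by (auto intro: desc.par2)
qed (rule desc.self)

lemma desc_cong:
  "\<forall>k\<in>{1..n}. s k = s' k \<Longrightarrow> m \<le> n \<Longrightarrow> m \<in> desc s u \<longleftrightarrow> m \<in> desc s' u"
  using desc_cong_imp[of m s u n s'] desc_cong_imp[of m s' u n s] by auto

locale delay_bounds =
  fixes H J :: nat
begin

definition valid :: "history \<Rightarrow> nat \<Rightarrow> bool" where
  "valid s n \<longleftrightarrow> (\<forall>k\<in>{1..n}. dur s k \<le> H \<and> lag s k \<le> J \<and>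
     par1 s k \<in> tip_set s (k - lag s k) \<and> par2 s k \<in> tip_set s (k - lag s k))"

text \<open>Within the delay window of length \<open>H + J\<close> the available tips and the free vertices differ by at
  most \<open>2 * (H + J)\<close> tips and \<open>H + J\<close> free vertices. Above this bound there are thus at least
  \<open>4 * (4 * (H + J) + 1)\<close> tips, which makes a wasted selection unlikely enough for drift \<open>-1/2\<close>.\<close>
definition free_bound :: nat where "free_bound = 4 * (4 * (H + J) + 1) + (H + J)"

text \<open>After this many steps even the most lagged view lies more than \<open>H\<close> beyond
  the start, so every selection made up to the start is visible.\<close>

definition block :: nat where "block = H + J + 2"

text \<open>Each of the first \<open>free_bound\<close> blocks removes one old free vertex; the last
  block lets these selections become visible.\<close>

definition run_goal :: nat where "run_goal = free_bound * block + block"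

text \<open>The bound on free vertices is tested only when a run starts, since the count may grow
  along it. It limits both the tips among which the next good pair is drawn and the old vertices
  that the run must use up.\<close>

primrec run :: "nat \<Rightarrow> history \<Rightarrow> nat \<Rightarrow> nat" where
  "run u s 0 = 0"
| "run u s (Suc n) =
    (if (0 < run u s n \<or> card (free s n) \<le> free_bound) \<and>
        par1 s (Suc n) \<in> desc s u \<and> par1 s (Suc n) < Suc n \<and>
        par2 s (Suc n) = Min (tip_set s (Suc n - lag s (Suc n)))
     then Suc (run u s n) else 0)"

text \<open>The factor bounds the number of parent pairs available during a run, so its inverse bounds the
  probability of a good step from below; the increment then outweighs the loss from breaking the run.\<close>
primrec run_reward :: "nat \<Rightarrow> real" where
  "run_reward 0 = 0"
| "run_reward (Suc r) = real (free_bound + run_goal + 2 * (H + J)) ^ 2 * (run_reward r + 3 / 2)"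

text \<open>The added constant makes the value non-negative, and \<open>min\<close> preserves this
  for runs longer than the goal.\<close>

definition potential :: "nat \<Rightarrow> history \<Rightarrow> nat \<Rightarrow> real" where
  "potential u s n =
     real (card (free s n)) + run_reward run_goal - run_reward (min (run u s n) run_goal)"

lemma valid_par_less:
  assumes "valid s n" "k \<in> {1..n}"
  shows "par1 s k < k" "par2 s k < k"
  using assms tip_set_less[of _ s "k - lag s k" k] by (auto simp: valid_def)

lemma run_cong: "\<forall>k\<in>{1..n}. s k = s' k \<Longrightarrow> run u s n = run u s' n"
proof (induction n)
  case (Suc n)
  then have ag: "\<forall>k\<in>{1..n}. s k = s' k" and e: "s (Suc n) = s' (Suc n)" by auto
  have "par1 s' (Suc n) < Suc n \<Longrightarrow> par1 s' (Suc n) \<in> desc s u \<longleftrightarrow> par1 s' (Suc n) \<in> desc s' u"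
    using desc_cong[OF ag] by simp
  then show ?case
    using Suc.IH[OF ag] free_cong[OF ag] tip_set_cong[OF ag, of "Suc n - lag s' (Suc n)"] e by auto
qed simp

lemma potential_cong: "\<forall>k\<in>{1..n}. s k = s' k \<Longrightarrow> potential u s n = potential u s' n"
  unfolding potential_def by (metis free_cong run_cong)

lemma run_reward_nonneg [simp]: "0 \<le> run_reward r"
  by (induction r) auto

lemma run_reward_mono: "r \<le> r' \<Longrightarrow> run_reward r \<le> run_reward r'"
proof (rule lift_Suc_mono_le)
  fix r
  have "1 \<le> real (free_bound + run_goal + 2 * (H + J)) ^ 2"
    by (rule one_le_power) (simp add: free_bound_def)
  then have "1 * (run_reward r + 3 / 2)
      \<le> real (free_bound + run_goal + 2 * (H + J)) ^ 2 * (run_reward r + 3 / 2)"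
    by (rule mult_right_mono) (simp add: add_nonneg_nonneg)
  then show "run_reward r \<le> run_reward (Suc r)" by simp
qed

lemma potential_nonneg: "0 \<le> potential u s n"
  using run_reward_mono[of "min (run u s n) run_goal" run_goal] by (simp add: potential_def)

lemma potential_le: "potential u s n \<le> real (Suc n) + run_reward run_goal"
  using card_free_le[of s n] run_reward_nonneg[of "min (run u s n) run_goal"]
  unfolding potential_def by linarith

lemma card_free_run: "0 < run u s n \<Longrightarrow> card (free s n) \<le> free_bound + run u s n"
proof (induction n)
  case (Suc n)
  then show ?case using card_free_Suc[of s n] by (auto split: if_splits)
qed simp

section \<open>Tips seen with delay versus free vertices\<close>

lemma card_tip_minus_free:
  assumes "valid s n" "j \<le> J"
  shows "card (tip_set s (Suc n - j) - free s n) \<le> 2 * (H + J)"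
proof -
  let ?A = "{Suc n - (H + J)..n}"
  \<comment> \<open>A visible tip that is no longer free was selected by some \<open>k\<close> whose
    arcs are still invisible; such \<open>k\<close> lie in the last \<open>H + J\<close> steps and
    have two parents each.\<close>
  have "tip_set s (Suc n - j) - free s n \<subseteq> par1 s ` ?A \<union> par2 s ` ?A"
  proof
    fix v assume v: "v \<in> tip_set s (Suc n - j) - free s n"
    then have "v \<le> n" using tip_set_less[of v s "Suc n - j" "Suc n"] by simp
    then obtain k where k: "k \<in> {1..n}" "par1 s k = v \<or> par2 s k = v" using v by (auto simp: free_def)
    then have "\<not> k + dur s k < Suc n - j" using v by (auto simp: tip_set_def)
    moreover have "dur s k \<le> H" using k assms by (auto simp: valid_def)
    ultimately have "k \<in> ?A" using k assms by auto
    then show "v \<in> par1 s ` ?A \<union> par2 s ` ?A" using k by blast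
  qed
  then have "card (tip_set s (Suc n - j) - free s n) \<le> card (par1 s ` ?A \<union> par2 s ` ?A)"
    by (rule card_mono[rotated]) simp
  also have "\<dots> \<le> card (par1 s ` ?A) + card (par2 s ` ?A)" by (rule card_Un_le)
  also have "\<dots> \<le> card ?A + card ?A" by (intro add_mono card_image_le) auto
  also have "\<dots> \<le> 2 * (H + J)" by simp
  finally show ?thesis .
qed

lemma card_free_minus_tip:
  assumes "valid s n" "j \<le> J"
  shows "card (free s n - tip_set s (Suc n - j)) \<le> H + J"
proof -
  let ?A = "{Suc n - (H + J)..n}"
  \<comment> \<open>An unselected vertex can fail to be a tip only by not having landed.\<close>
  have "free s n - tip_set s (Suc n - j) \<subseteq> ?A"
  proof
    fix v assume v: "v \<in> free s n - tip_set s (Suc n - j)"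
    then have "v \<notin> landed s (Suc n - j)" "v \<le> n" by (auto simp: tip_set_def free_def)
    then have *: "v \<in> {1..n}" "\<not> v + dur s v < Suc n - j" by (auto simp: landed_def)
    moreover from *(1) have "dur s v \<le> H" using assms unfolding valid_def by blast
    ultimately show "v \<in> ?A" using assms(2) by auto
  qed
  then have "card (free s n - tip_set s (Suc n - j)) \<le> card ?A" by (rule card_mono[rotated]) simp
  then show ?thesis by simp
qed

lemma card_tip_le:
  assumes "valid s n" "j \<le> J"
  shows "card (tip_set s (Suc n - j)) \<le> card (free s n) + 2 * (H + J)"
proof -
  have "card (tip_set s (Suc n - j)) \<le> card (free s n \<union> (tip_set s (Suc n - j) - free s n))"
    by (rule card_mono) auto
  also have "\<dots> \<le> card (free s n) + card (tip_set s (Suc n - j) - free s n)" by (rule card_Un_le)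
  finally show ?thesis using card_tip_minus_free[OF assms] by simp
qed

lemma card_free_le_tip:
  assumes "valid s n" "j \<le> J"
  shows "card (free s n) \<le> card (tip_set s (Suc n - j)) + (H + J)"
proof -
  have "card (free s n) \<le> card (tip_set s (Suc n - j) \<union> (free s n - tip_set s (Suc n - j)))"
    by (rule card_mono) auto
  also have "\<dots> \<le> card (tip_set s (Suc n - j)) + card (free s n - tip_set s (Suc n - j))"
    by (rule card_Un_le)
  finally show ?thesis using card_free_minus_tip[OF assms] by simp
qed

text \<open>The largest landed descendant of \<open>u\<close> is a tip: a visible child of it would
  be a larger landed descendant.\<close>

lemma desc_tip_exists:
  assumes "valid s n" "t \<le> Suc n" "u \<in> landed s t"
  shows "\<exists>v \<in> tip_set s t. v \<in> desc s u"
proof -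
  let ?A = "desc s u \<inter> landed s t"
  define v where "v = Max ?A"
  have "?A \<noteq> {}" using assms desc.self by blast
  then have v: "v \<in> ?A" unfolding v_def by (intro Max_in) auto
  have max: "k \<le> v" if "k \<in> ?A" for k unfolding v_def by (rule Max_ge) (use that in auto)
  have "par1 s k \<noteq> v \<and> par2 s k \<noteq> v" if k: "1 \<le> k" "k + dur s k < t" for k
  proof (rule ccontr)
    assume c: "\<not> ?thesis"
    have "k \<in> {1..n}" using k assms(2) by auto
    then have "par1 s k < k" "par2 s k < k" using valid_par_less[OF assms(1)] by auto
    then have "k \<in> desc s u" "v < k" using c v desc.par1[of s k u] desc.par2[of s k u] by auto
    moreover have "k \<in> landed s t" using k by (simp add: landed_def)
    ultimately show False using max[of k] by simp
  qed
  then show ?thesis using v by (auto simp: tip_set_def)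
qed

lemma landed_late:
  assumes "valid s n" "u \<le> n" "u + H < t"
  shows "u \<in> landed s t"
proof (cases "u = 0")
  case False
  then have "dur s u \<le> H" using assms unfolding valid_def by auto
  then show ?thesis using assms False by (auto simp: landed_def)
qed (simp add: landed_def)

text \<open>Two distinct free parents leave and one vertex enters, a net change of -1; otherwise the
  count rises by at most 1. The excess 2 is charged to each failure, so that the bound can be summed
  over all pairs.\<close>

lemma card_free_step:
  assumes "v \<le> n" "v' \<le> n"
  shows "real (card (free (s(Suc n := (d, j, v, v'))) (Suc n))) \<le> real (card (free s n)) - 1
    + 2 * (of_bool (v \<notin> free s n) + of_bool (v' \<notin> free s n) + of_bool (v = v'))"
proof -
  let ?s = "s(Suc n := (d, j, v, v'))"
  have F: "free ?s n = free s n" by (rule free_cong) simp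
  have sub: "free ?s (Suc n) \<subseteq> insert (Suc n) (free s n - {v, v'})"
    using free_Suc_subset[of ?s n] F by simp
  show ?thesis
  proof (cases "v \<in> free s n \<and> v' \<in> free s n \<and> v \<noteq> v'")
    case True
    have c: "card {v, v'} = 2" using True by simp
    have "card (free ?s (Suc n)) \<le> card (insert (Suc n) (free s n - {v, v'}))"
      by (rule card_mono) (use sub in auto)
    also have "\<dots> \<le> Suc (card (free s n - {v, v'}))" by (simp add: card_insert_if)
    also have "card (free s n - {v, v'}) = card (free s n) - 2"
      using True c by (subst card_Diff_subset) auto
    finally have "card (free ?s (Suc n)) \<le> Suc (card (free s n) - 2)" .
    moreover have "card {v, v'} \<le> card (free s n)" by (rule card_mono) (use True in auto)
    ultimately show ?thesis using True c by simp
  next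
    case False
    then have "(1 :: real) \<le> of_bool (v \<notin> free s n) + of_bool (v' \<notin> free s n) + of_bool (v = v')"
      by auto
    moreover have "real (card (free ?s (Suc n))) \<le> real (card (free s n)) + 1"
      using card_free_Suc[of ?s n] F by (simp del: fun_upd_apply)
    moreover have "x \<le> f - 1 + 2 * b" if "1 \<le> b" "x \<le> f + 1" for x f b :: real
      using that by linarith
    ultimately show ?thesis by blast
  qed
qed

text \<open>Up to the factor \<open>real (card T) ^ 2\<close>, the double sum is the conditional
  expectation of the next potential given duration \<open>d\<close> and lag \<open>j\<close>. With
  many free vertices and no run, the count itself drifts down; otherwise the reward for a single
  good pair outweighs the worst case for all others.\<close>

lemma potential_drift:
  assumes valid: "valid s n" and j: "j \<le> J" and late: "u + H + J \<le> n"
    and unfinished: "run u s n < run_goal"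
  defines "T \<equiv> tip_set s (Suc n - j)"
  shows "(\<Sum>v\<in>T. \<Sum>v'\<in>T. potential u (s(Suc n := (d, j, v, v'))) (Suc n))
    \<le> real (card T) ^ 2 * (potential u s n - 1 / 2)"
proof -
  define L where "L = real (card T)"
  define \<Phi> where "\<Phi> = real (card (free s n))"
  define S where "S v v' = s(Suc n := (d, j, v, v'))" for v v'
  have ag: "\<forall>k\<in>{1..n}. S v v' k = s k" for v v' by (simp add: S_def)
  have T_le: "v \<le> n" if "v \<in> T" for v
    using tip_set_less[of v s "Suc n - j" "Suc n"] that by (simp add: T_def)
  have [simp]: "finite T" by (simp add: T_def)
  have runS: "run u (S v v') (Suc n) =
    (if (0 < run u s n \<or> card (free s n) \<le> free_bound) \<and> v \<in> desc s u \<and> v' = Min T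
     then Suc (run u s n) else 0)" if "v \<in> T" for v v'
  proof -
    have "v \<in> desc (S v v') u \<longleftrightarrow> v \<in> desc s u"
      by (rule desc_cong[OF ag]) (rule T_le[OF that])
    moreover have "tip_set (S v v') (Suc n - j) = T"
      unfolding T_def by (rule tip_set_cong[OF ag]) simp
    moreover have "v < Suc n" using T_le[OF that] by simp
    ultimately show ?thesis
      unfolding run.simps run_cong[OF ag] free_cong[OF ag] by (simp add: S_def)
  qed
  have drift: "potential u (S v v') (Suc n) = card (free (S v v') (Suc n)) + run_reward run_goal
      - run_reward (run u (S v v') (Suc n))" if "v \<in> T" for v v'
  proof -
    have "run u (S v v') (Suc n) \<le> run_goal"
      unfolding runS[OF that] using unfinished by simp
    then show ?thesis by (simp add: potential_def del: run.simps)
  qed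
  have now: "potential u s n = \<Phi> + run_reward run_goal - run_reward (run u s n)"
    using unfinished by (simp add: potential_def \<Phi>_def)
  show ?thesis
  proof (cases "0 < run u s n \<or> card (free s n) \<le> free_bound")
    case False
    have "card (T - free s n) \<le> 2 * (H + J)" unfolding T_def by (rule card_tip_minus_free[OF valid j])
    moreover have "(\<Sum>v\<in>T. of_bool (v \<notin> free s n) :: real) = real (card (T - free s n))"
      by (simp add: of_bool_def sum.If_cases Diff_eq Int_def)
    ultimately have out: "(\<Sum>v\<in>T. of_bool (v \<notin> free s n)) \<le> 2 * real (H + J)" by simp
    have diag: "(\<Sum>v\<in>T. \<Sum>v'\<in>T. of_bool (v = v')) = L"
      by (simp add: of_bool_def L_def)
    \<comment> \<open>Over all pairs the failures cost at most
      \<open>2 * L * (4 * (H + J) + 1)\<close>. This bound keeps the cost below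
      \<open>L ^ 2 / 2\<close>, half of the gain of 1 per pair. No reward is involved, since no run
      can start here.\<close>
    have Lbig: "4 * (4 * real (H + J) + 1) \<le> L"
    proof -
      have "free_bound < card (free s n)" using False by simp
      then have "4 * (4 * (H + J) + 1) \<le> card T"
        using card_free_le_tip[OF valid j] unfolding T_def free_bound_def by linarith
      then have "real (4 * (4 * (H + J) + 1)) \<le> L" unfolding L_def of_nat_le_iff .
      then show ?thesis by simp
    qed
    have "(\<Sum>v\<in>T. \<Sum>v'\<in>T. potential u (S v v') (Suc n))
      \<le> (\<Sum>v\<in>T. \<Sum>v'\<in>T. \<Phi> - 1 + run_reward run_goal
          + 2 * (of_bool (v \<notin> free s n) + of_bool (v' \<notin> free s n) + of_bool (v = v')))"
    proof (intro sum_mono)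
      fix v v' assume v: "v \<in> T" "v' \<in> T"
      have "potential u (S v v') (Suc n) = card (free (S v v') (Suc n)) + run_reward run_goal"
        using drift[OF v(1)] runS[OF v(1)] False by simp
      then show "potential u (S v v') (Suc n) \<le> \<Phi> - 1 + run_reward run_goal
          + 2 * (of_bool (v \<notin> free s n) + of_bool (v' \<notin> free s n) + of_bool (v = v'))"
        using card_free_step[OF T_le[OF v(1)] T_le[OF v(2)], of s d j] unfolding \<Phi>_def S_def
        by linarith
    qed
    also have "\<dots> = L ^ 2 * (\<Phi> - 1 + run_reward run_goal)
        + 2 * (2 * L * (\<Sum>v\<in>T. of_bool (v \<notin> free s n)) + L)"
      unfolding sum.distrib sum_distrib_left[symmetric] sum_constant diag L_def[symmetric]
      by (simp add: power2_eq_square algebra_simps)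
    also have "\<dots> \<le> L ^ 2 * (\<Phi> - 1 + run_reward run_goal) + 2 * (2 * L * (2 * real (H + J)) + L)"
      using out by (simp add: L_def mult_left_mono)
    also have "\<dots> = L ^ 2 * (\<Phi> - 1 + run_reward run_goal) + L * (4 * (4 * real (H + J) + 1)) / 2"
      by (simp add: algebra_simps)
    also have "\<dots> \<le> L ^ 2 * (\<Phi> - 1 + run_reward run_goal) + L * L / 2"
      using mult_left_mono[OF Lbig, of L] by (simp add: L_def)
    also have "\<dots> = L ^ 2 * (potential u s n - 1 / 2)"
      using False by (simp add: now power2_eq_square algebra_simps)
    finally show ?thesis unfolding S_def L_def .
  next
    case True
    have "card (free s n) \<le> free_bound + run_goal"
      using True card_free_run[of u s n] unfinished by auto
    then have "card T \<le> free_bound + run_goal + 2 * (H + J)"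
      using card_tip_le[OF valid j] unfolding T_def by simp
    then have "L \<le> real (free_bound + run_goal + 2 * (H + J))" unfolding L_def of_nat_le_iff .
    then have Lsmall: "L ^ 2 \<le> real (free_bound + run_goal + 2 * (H + J)) ^ 2"
      by (rule power_mono) (simp add: L_def)
    have "u \<in> landed s (Suc n - j)" using late j by (intro landed_late[OF valid]) auto
    then obtain w where w: "w \<in> T" "w \<in> desc s u"
      using desc_tip_exists[OF valid, of "Suc n - j" u] by (auto simp: T_def)
    have MinT: "Min T \<in> T" using w by (intro Min_in) auto
    \<comment> \<open>One good pair suffices: \<open>w\<close> descends from \<open>u\<close> and
      \<open>Min T\<close> is the oldest tip. All other pairs are credited with no reward.\<close>
    define Z where "Z v v' = (of_bool (v = w \<and> v' = Min T) :: real)" for v v'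
    have "(\<Sum>v\<in>T. \<Sum>v'\<in>T. potential u (S v v') (Suc n))
      \<le> (\<Sum>v\<in>T. \<Sum>v'\<in>T. \<Phi> + 1 + run_reward run_goal - run_reward (Suc (run u s n)) * Z v v')"
    proof (intro sum_mono)
      fix v v' assume v: "v \<in> T" "v' \<in> T"
      have "card (free (S v v') (Suc n)) \<le> Suc (card (free s n))"
        using card_free_Suc[of "S v v'" n] free_cong[OF ag[of v v']] by simp
      moreover have "run_reward (Suc (run u s n)) * Z v v' \<le> run_reward (run u (S v v') (Suc n))"
        using w True runS[OF v(1), of v'] by (auto simp: Z_def simp del: run.simps run_reward.simps(2))
      ultimately show "potential u (S v v') (Suc n)
          \<le> \<Phi> + 1 + run_reward run_goal - run_reward (Suc (run u s n)) * Z v v'"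
        unfolding drift[OF v(1)] \<Phi>_def by linarith
    qed
    also have "\<dots> = L ^ 2 * (\<Phi> + 1 + run_reward run_goal)
        - run_reward (Suc (run u s n)) * (\<Sum>v\<in>T. \<Sum>v'\<in>T. Z v v')"
      unfolding sum_subtractf sum_distrib_left[symmetric] sum_constant L_def[symmetric]
      by (simp add: power2_eq_square algebra_simps del: run_reward.simps)
    also have "(\<Sum>v\<in>T. \<Sum>v'\<in>T. Z v v') = (\<Sum>v\<in>T. if v = w then 1 else 0)"
    proof (rule sum.cong[OF refl])
      fix v
      show "(\<Sum>v'\<in>T. Z v v') = (if v = w then 1 else 0)"
        using MinT by (cases "v = w") (simp_all add: Z_def of_bool_def)
    qed
    also have "\<dots> = 1" using w by simp
    \<comment> \<open>This is where the recursion of \<open>run_reward\<close> comes from: per pair,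
      \<open>run_reward (run u s n)\<close> pays for losing the current run, and
      \<open>3 / 2\<close> pays for one new free vertex plus the drift 1/2.\<close>
    also have "L ^ 2 * (\<Phi> + 1 + run_reward run_goal) - run_reward (Suc (run u s n)) * 1
      \<le> L ^ 2 * (\<Phi> + 1 + run_reward run_goal) - L ^ 2 * (run_reward (run u s n) + 3 / 2)"
      using mult_right_mono[OF Lsmall, of "run_reward (run u s n) + 3 / 2"]
      by (simp add: add_nonneg_nonneg)
    also have "\<dots> = L ^ 2 * (potential u s n - 1 / 2)"
      by (simp add: now algebra_simps)
    finally show ?thesis unfolding S_def L_def .
  qed
qed

section \<open>What a completed run forces\<close>

lemma run_le: "run u s n \<le> n"
  by (induction n) auto

lemma run_attains: "r \<le> run u s n \<Longrightarrow> \<exists>m\<le>n. run u s m = r"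
proof (induction n)
  case (Suc n)
  show ?case
  proof (cases "r \<le> run u s n")
    case True
    then show ?thesis using Suc.IH le_SucI by blast
  next
    case False
    then have "run u s (Suc n) = r" using Suc.prems by (auto split: if_splits)
    then show ?thesis by blast
  qed
qed auto

text \<open>Unwinding the recursion leads back to \<open>N - r\<close>, where the run started and
  the bound on free vertices was tested.\<close>

lemma run_steps:
  assumes "run u s N = r" "0 < r"
  shows "card (free s (N - r)) \<le> free_bound \<and> (\<forall>m\<in>{N - r<..N}.
    m \<in> desc s u \<and> par2 s m = Min (tip_set s (m - lag s m)))"
  using assms
proof (induction N arbitrary: r)
  case (Suc N)
  have step: "0 < run u s N \<or> card (free s N) \<le> free_bound"
    "par1 s (Suc N) \<in> desc s u" "par1 s (Suc N) < Suc N"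
    "par2 s (Suc N) = Min (tip_set s (Suc N - lag s (Suc N)))" "r = Suc (run u s N)"
    using Suc.prems by (auto split: if_splits)
  have new: "Suc N \<in> desc s u" using step desc.par1 by blast
  have old: "card (free s (N - run u s N)) \<le> free_bound \<and> (\<forall>m\<in>{N - run u s N<..N}.
    m \<in> desc s u \<and> par2 s m = Min (tip_set s (m - lag s m)))"
    using Suc.IH[of "run u s N"] step(1) by (cases "run u s N = 0") auto
  have "{Suc N - r<..Suc N} = insert (Suc N) {N - run u s N<..N}"
    using step(5) by auto
  then show ?case using old new step(4,5) by auto
qed simp

lemma tip_set_unselected:
  assumes "valid s k" "1 \<le> k" "k + H < t" "v \<in> tip_set s t"
  shows "par1 s k \<noteq> v \<and> par2 s k \<noteq> v"
proof -
  have "dur s k \<le> H" using assms(1,2) by (simp add: valid_def)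
  then show ?thesis using assms by (auto simp: tip_set_def)
qed

text \<open>Along a run every new vertex kills the oldest tip, so each block of steps selects a further
  vertex that was still free when the run started.\<close>
lemma run_goal_imp_desc:
  assumes valid: "\<And>n. valid s n" and run: "run u s N = run_goal"
  shows "\<forall>m>N - run_goal. m \<in> desc s u"
proof -
  define a where "a = N - run_goal"
  have pos: "0 < run_goal" by (simp add: run_goal_def block_def)
  have N: "N = a + run_goal" using run_le[of u s N] run by (simp add: a_def)
  have start: "card (free s a) \<le> free_bound"
    and steps: "\<And>m. a < m \<Longrightarrow> m \<le> N \<Longrightarrow> m \<in> desc s u \<and> par2 s m = Min (tip_set s (m - lag s m))"
    using run_steps[OF run pos] by (auto simp: a_def)
  define old where "old b = free s b \<inter> {..a}" for b
  have shrink: "card (old (b + block)) < card (old b)"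
    if b: "a \<le> b" "b + block \<le> N" "old (b + block) \<noteq> {}" for b
  proof -
    define m where "m = b + block"
    define t where "t = m - lag s m"
    have "lag s m \<le> J" using valid[of m] unfolding valid_def m_def block_def by auto
    then have t: "b + H < t" "t \<le> m" by (auto simp: t_def m_def block_def)
    obtain v where v: "v \<in> free s m" "v \<le> a" using b(3) by (auto simp: old_def m_def)
    have "v \<in> landed s t" using b t v by (intro landed_late[OF valid order_refl]) auto
    then have vt: "v \<in> tip_set s t" using v(1) t(2) by (auto simp: tip_set_def free_def)
    define y where "y = par2 s m"
    have y: "y = Min (tip_set s t)" using steps[of m] b by (auto simp: y_def t_def m_def block_def)
    then have yt: "y \<in> tip_set s t" using vt by (metis Min_in empty_iff finite_tip_set)
    \<comment> \<open>Here the choice of the oldest tip matters: \<open>y\<close> lies below the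
      surviving old vertex \<open>v\<close>, so it is old itself. It was free at \<open>b\<close>
      because all selections up to \<open>b\<close> are visible at \<open>t\<close>, and step
      \<open>m\<close> uses it up.\<close>
    have "y \<le> v" using vt y by simp
    then have "y \<in> old b" using tip_set_unselected[OF valid _ _ yt] t(1) v(2) b(1)
      by (auto simp: old_def free_def)
    moreover have "y \<notin> old m" using b(1) by (auto simp: old_def free_def y_def m_def block_def)
    moreover have "old m \<subseteq> old b" using b(1) by (auto simp: old_def free_def m_def)
    ultimately have "old m \<subset> old b" by auto
    then show ?thesis unfolding m_def by (intro psubset_card_mono) (auto simp: old_def)
  qed
  have "i \<le> free_bound \<Longrightarrow> card (old (a + i * block)) \<le> free_bound - i" for i
  proof (induction i)
    case 0
    have "card (old a) \<le> card (free s a)" by (rule card_mono) (auto simp: old_def)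
    then show ?case using start by simp
  next
    case (Suc i)
    show ?case
    proof (cases "old (a + i * block + block) = {}")
      case False
      have "Suc i * block \<le> free_bound * block" using Suc.prems by (rule mult_le_mono1)
      then have "a + i * block + block \<le> N" unfolding N run_goal_def mult_Suc by linarith
      then have "card (old (a + i * block + block)) < card (old (a + i * block))"
        using shrink[of "a + i * block"] False by simp
      then show ?thesis using Suc by (simp add: add.commute add.left_commute)
    qed (simp add: add.commute add.left_commute)
  qed
  from this[of free_bound] have empty: "old (a + free_bound * block) = {}"
    by (simp add: old_def)
  \<comment> \<open>Once \<open>H\<close> further steps have passed, all selections made up to
    \<open>a + free_bound * block\<close> are visible, so a tip of index at most \<open>a\<close>
    would still be in the empty set \<open>old\<close>.\<close>
  have tips_new: "a < v" if t: "a + free_bound * block + H < t" and v: "v \<in> tip_set s t" for v t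
  proof (rule ccontr)
    assume "\<not> a < v"
    then have "v \<in> old (a + free_bound * block)"
      using tip_set_unselected[OF valid _ _ v] t by (auto simp: old_def free_def)
    then show False using empty by simp
  qed
  \<comment> \<open>Beyond \<open>N\<close> the last block of \<open>run_goal\<close> covers lag and
    duration, so the first parent exceeds \<open>a\<close> and the induction hypothesis applies to
    it.\<close>
  have "m \<in> desc s u" if "a < m" for m
    using that
  proof (induction m rule: less_induct)
    case (less m)
    show ?case
    proof (cases "m \<le> N")
      case False
      have m: "lag s m \<le> J" "par1 s m \<in> tip_set s (m - lag s m)"
        using valid[of m] less.prems by (auto simp: valid_def)
      then have "a < par1 s m" using tips_new[of "m - lag s m"] False
        by (auto simp: N run_goal_def block_def)
      moreover have "par1 s m < m" using valid_par_less[OF valid, of m m] less.prems by simp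
      ultimately show ?thesis using less.IH desc.par1 by blast
    qed (use steps less.prems in simp)
  qed
  then show ?thesis by (simp add: a_def)
qed

end


section \<open>Limit graph and rays\<close>

text \<open>Covers both the graph at a finite time, \<open>S = landed s t\<close>, and the limit,
  \<open>S = UNIV\<close>: vertices arrive together with their outgoing arcs, so the vertex set
  determines the graph.\<close>

definition hist_graph :: "history \<Rightarrow> nat set \<Rightarrow> dag" where
  "hist_graph s S = \<lparr>pverts = S, parcs = {(k, v). k \<in> S \<and> 1 \<le> k \<and> (v = par1 s k \<or> v = par2 s k)}\<rparr>"

lemma pverts_hist_graph [simp]: "pverts (hist_graph s S) = S"
  by (simp add: hist_graph_def)

lemma parcs_hist_graph:
  "(k, v) \<in> parcs (hist_graph s S) \<longleftrightarrow> k \<in> S \<and> 1 \<le> k \<and> (v = par1 s k \<or> v = par2 s k)"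
  by (simp add: hist_graph_def)

lemma tangle_nat_eq:
  "tangle_nat \<Theta> X Y \<omega> n = hist_graph (\<lambda>k. (\<Theta> k \<omega>, e k, X k \<omega>, Y k \<omega>)) (landed (\<lambda>k. (\<Theta> k \<omega>, e k, X k \<omega>, Y k \<omega>)) n)"
proof (induction n)
  case (Suc n)
  have "k + d < Suc n \<longleftrightarrow> k + d < n \<or> k + d = n" for k d :: nat by auto
  then show ?case unfolding tangle_nat.simps Suc by (auto simp: hist_graph_def landed_def)
qed (auto simp: hist_graph_def landed_def)

lemma tangle_eq:
  defines "s \<equiv> \<lambda>\<Theta> \<epsilon> X Y \<omega> k. (\<Theta> k \<omega>, \<epsilon> k \<omega>, X k \<omega>, Y k \<omega>)"
  shows "tangle \<Theta> X Y \<omega> (int n - int j) =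
    hist_graph (s \<Theta> \<epsilon> X Y \<omega>) (landed (s \<Theta> \<epsilon> X Y \<omega>) (n - j))"
proof (cases "j \<le> n")
  case True
  then have "int n - int j = int (n - j)" by simp
  then show ?thesis
    by (simp add: tangle_def tangle_nat_eq[where e = "\<lambda>k. \<epsilon> k \<omega>"] s_def del: of_nat_diff)
next
  case False
  then show ?thesis
    by (simp add: tangle_def tangle_nat_eq[where e = "\<lambda>k. \<epsilon> k \<omega>"] s_def del: tangle_nat.simps)
qed

lemma tips_hist_graph: "tips (hist_graph s (landed s t)) = tip_set s t"
  by (auto simp: tips_def tip_set_def parcs_hist_graph) (auto simp: landed_def)

lemma sym_arc_iff:
  fixes G :: dag
  shows "(u, v) \<in> parcs (mk_symmetric G) \<longleftrightarrow> (u, v) \<in> parcs G \<or> (v, u) \<in> parcs G"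
  unfolding parcs_mk_symmetric with_proj_simps UN_iff
  by (auto intro: bexI[of _ "(u, v)"] bexI[of _ "(v, u)"])

text \<open>Iterating first parents lowers the label and so leads to the root; decreasing labels
  also exclude cycles. Out-degrees are at most two, so local finiteness reduces to finitely many
  children.\<close>

lemma hist_graph_in_dag_space:
  assumes zero: "0 \<in> S"
    and closed: "\<And>k. k \<in> S \<Longrightarrow> 1 \<le> k \<Longrightarrow> par1 s k \<in> S \<and> par2 s k \<in> S"
    and less: "\<And>k. k \<in> S \<Longrightarrow> 1 \<le> k \<Longrightarrow> par1 s k < k \<and> par2 s k < k"
    and finite_children: "\<And>v. v \<in> S \<Longrightarrow> finite {k \<in> S. 1 \<le> k \<and> (par1 s k = v \<or> par2 s k = v)}"
  shows "hist_graph s S \<in> dag_space"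
proof -
  let ?G = "hist_graph s S"
  have wf: "pair_wf_digraph ?G"
    using closed by unfold_locales (auto simp: parcs_hist_graph)
  interpret S: pair_wf_digraph "mk_symmetric ?G"
    using wf by (intro wf_digraph.wellformed_mk_symmetric) (simp add: wf_digraph_wp_iff)
  have root: "0 \<rightarrow>\<^sup>*\<^bsub>mk_symmetric ?G\<^esub> k \<and> k \<rightarrow>\<^sup>*\<^bsub>mk_symmetric ?G\<^esub> 0" if "k \<in> S" for k
    using that
  proof (induction k rule: less_induct)
    case (less k)
    show ?case
    proof (cases "k = 0")
      case True
      then show ?thesis using zero by (intro conjI S.reachable_refl) simp_all
    next
      case False
      then have p: "par1 s k \<in> S" "par1 s k < k" using closed assms(3) less.prems by auto
      have "(k, par1 s k) \<in> parcs (mk_symmetric ?G)" "(par1 s k, k) \<in> parcs (mk_symmetric ?G)"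
        using False less.prems by (auto simp: sym_arc_iff parcs_hist_graph)
      then show ?thesis
        using less.IH[OF p(2,1)] S.reachable_adj_trans S.adj_reachable_trans by blast
    qed
  qed
  have "Digraph_Component.connected (with_proj ?G)"
    unfolding Digraph_Component.connected_def strongly_connected_def
  proof (intro conjI ballI)
    show "verts (with_proj (mk_symmetric ?G)) \<noteq> {}" using zero by auto
    show "u \<rightarrow>\<^sup>*\<^bsub>mk_symmetric ?G\<^esub> v"
      if "u \<in> verts (with_proj (mk_symmetric ?G))" "v \<in> verts (with_proj (mk_symmetric ?G))" for u v
      by (rule S.reachable_trans[of u 0 v]) (use root that in simp_all)
  qed
  moreover have "acyclic (parcs ?G)"
  proof (rule acyclicI_order[where f = id])
    show "id v < id k" if "(k, v) \<in> parcs ?G" for k v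
      using that less by (auto simp: parcs_hist_graph)
  qed
  moreover have "finite (in_arcs ?G v)" if "v \<in> S" for v
  proof (rule finite_subset)
    show "in_arcs ?G v \<subseteq> (\<lambda>k. (k, v)) ` {k \<in> S. 1 \<le> k \<and> (par1 s k = v \<or> par2 s k = v)}"
      by (auto simp: in_arcs_def parcs_hist_graph)
  qed (use finite_children[OF that] in simp)
  moreover have "finite (out_arcs ?G v)" for v
    by (rule finite_subset[of _ "{(v, par1 s v), (v, par2 s v)}"])
      (auto simp: out_arcs_def parcs_hist_graph)
  ultimately show ?thesis using wf zero by (simp add: dag_space_def)
qed

section \<open>Convergence of balls around the root\<close>

lemma finite_ball_verts:
  assumes "G \<in> dag_space" shows "finite (ball_verts r G)"
proof (induction r)
  case (Suc r)
  have wf: "pair_wf_digraph G" using assms by (simp add: dag_space_def)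
  have "{v. \<exists>u\<in>ball_verts r G. (u, v) \<in> parcs (mk_symmetric G)}
      \<subseteq> (\<Union>u\<in>ball_verts r G. snd ` out_arcs G u \<union> fst ` in_arcs G u)"
    by (force simp: sym_arc_iff in_arcs_def out_arcs_def)
  moreover have "finite (\<Union>u\<in>ball_verts r G. snd ` out_arcs G u \<union> fst ` in_arcs G u)"
    using Suc ball_verts_subset[OF wf, of r] assms by (auto simp: dag_space_def)
  ultimately show ?case unfolding ball_verts_Suc[OF wf] using Suc
    by (simp add: finite_subset)
qed (simp add: ball_verts_0)

text \<open>By induction on the radius: a new vertex of the ball in \<open>H\<close> is attached to
  the smaller ball by an arc inside the \<open>r\<close>-ball, and \<open>cover\<close> puts this
  arc into \<open>G\<close>.\<close>

lemma root_ball_subgraph: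
  assumes wf: "pair_wf_digraph G" "pair_wf_digraph H"
    and sub: "pverts G \<subseteq> pverts H" "parcs G \<subseteq> parcs H" and zero: "0 \<in> pverts G"
    and cover: "Restr (parcs H) (ball_verts r H) \<subseteq> parcs G"
  shows "root_ball r G = root_ball r H"
proof -
  have "ball_verts q G = ball_verts q H" if "q \<le> r" for q
    using that
  proof (induction q)
    case 0
    then show ?case using zero sub by (auto simp: ball_verts_0)
  next
    case (Suc q)
    then have IH: "ball_verts q G = ball_verts q H" by simp
    show ?case
    proof
      show "ball_verts (Suc q) G \<subseteq> ball_verts (Suc q) H"
        using sub(2) unfolding ball_verts_Suc[OF wf(1)] ball_verts_Suc[OF wf(2)] IH
        by (auto simp: sym_arc_iff)
      show "ball_verts (Suc q) H \<subseteq> ball_verts (Suc q) G"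
      proof
        fix v assume v: "v \<in> ball_verts (Suc q) H"
        show "v \<in> ball_verts (Suc q) G"
        proof (cases "v \<in> ball_verts q H")
          case True
          then show ?thesis using IH ball_verts_mono[of q "Suc q" G] by auto
        next
          case False
          then obtain u where u: "u \<in> ball_verts q H" "(u, v) \<in> parcs (mk_symmetric H)"
            using v ball_verts_Suc[OF wf(2)] by auto
          have "u \<in> ball_verts r H" "v \<in> ball_verts r H"
            using u(1) v Suc.prems ball_verts_mono[of q r H] ball_verts_mono[of "Suc q" r H] by auto
          then have "(u, v) \<in> parcs (mk_symmetric G)" using u(2) cover by (auto simp: sym_arc_iff)
          then show ?thesis using u(1) IH ball_verts_Suc[OF wf(1)] by auto
        qed
      qed
    qed
  qed
  then show ?thesis using sub cover unfolding root_ball_eq_iff by auto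
qed

lemma limitin_dag_spaceI:
  assumes "\<And>n. F n \<in> dag_space" "G \<in> dag_space"
    and "\<And>r. eventually (\<lambda>n. root_ball r (F n) = root_ball r G) sequentially"
  shows "limitin dag_metric.mtopology F G sequentially"
  unfolding dag_metric.limitin_metric
proof (intro conjI allI impI assms(2))
  fix e :: real assume "0 < e"
  then obtain r where r: "inverse (real (Suc r)) < e" using reals_Archimedean by blast
  show "eventually (\<lambda>n. F n \<in> dag_space \<and> dag_dist (F n) G < e) sequentially"
    using assms(3)[of r]
  proof eventually_elim
    case (elim n)
    then have "dag_dist (F n) G \<le> inverse (real r + 1)"
      using dag_dist_le_iff[OF assms(1,2)] by blast
    then show ?case using r assms(1) by (simp add: add.commute)
  qed
qed

text \<open>The path is produced by a walk with state \<open>(v, i)\<close>: stand at \<open>v\<close>, head for \<open>c i\<close>.\<close>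
lemma path_through:
  fixes E :: "nat rel" and c :: "nat \<Rightarrow> nat"
  assumes chain: "\<And>i. (c i, c (Suc i)) \<in> E\<^sup>+" and incr: "\<And>u v. (u, v) \<in> E \<Longrightarrow> u < v"
  shows "\<exists>p. (\<forall>n. (p n, p (Suc n)) \<in> E) \<and> range c \<subseteq> range p"
proof -
  \<comment> \<open>The clause for \<open>n = 0\<close> pins the start of the walk, which the choice
    principle leaves open.\<close>
  define P where "P = (\<lambda>n::nat. \<lambda>(v, i). (v, c i) \<in> E\<^sup>+ \<and> (n = 0 \<longrightarrow> v = c 0 \<and> i = Suc 0))"
  define Q where "Q = (\<lambda>n::nat. \<lambda>(v, i) (v', i'). (v, v') \<in> E \<and> (i' = i \<or> i' = Suc i \<and> v' = c i))"
  have "\<exists>f. \<forall>n. P n (f n) \<and> Q n (f n) (f (Suc n))"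
  proof (rule dependent_nat_choice)
    show "\<exists>x. P 0 x" using chain[of 0] by (auto simp: P_def)
    fix x n assume "P n x"
    then obtain v i where x: "x = (v, i)" "(v, c i) \<in> E\<^sup>+" by (auto simp: P_def)
    then obtain v' where v': "(v, v') \<in> E" "(v', c i) \<in> E\<^sup>*" by (meson tranclD)
    show "\<exists>y. P (Suc n) y \<and> Q n x y"
    proof (cases "v' = c i")
      case True
      then show ?thesis using v' chain[of i] x
        by (intro exI[of _ "(v', Suc i)"]) (auto simp: P_def Q_def)
    next
      case False
      then have "(v', c i) \<in> E\<^sup>+" using v'(2) by (simp add: rtrancl_eq_or_trancl)
      then show ?thesis using v' x by (intro exI[of _ "(v', i)"]) (auto simp: P_def Q_def)
    qed
  qed
  then obtain f where f: "\<And>n. P n (f n)" "\<And>n. Q n (f n) (f (Suc n))" by blast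
  define p where "p n = fst (f n)" for n
  define idx where "idx n = snd (f n)" for n
  have step: "(p n, p (Suc n)) \<in> E" "idx (Suc n) = idx n \<or> idx (Suc n) = Suc (idx n) \<and> p (Suc n) = c (idx n)" for n
    using f(2)[of n] by (auto simp: Q_def p_def idx_def split: prod.splits)
  have mono: "strict_mono p" using step(1) incr by (auto intro: strict_mono_Suc_iff[THEN iffD2])
  have less: "p n < c (idx n)" for n
  proof -
    have "(p n, c (idx n)) \<in> E\<^sup>+" using f(1)[of n] by (auto simp: P_def p_def idx_def split: prod.splits)
    then show ?thesis by induction (use incr less_trans in blast)+
  qed
  have reach: "\<exists>n. idx n = Suc i \<and> p n = c i" for i
  proof (induction i)
    case 0
    show ?case using f(1)[of 0] by (intro exI[of _ 0]) (auto simp: P_def p_def idx_def split: prod.splits)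
  next
    case (Suc i)
    then obtain n where n: "idx n = Suc i" by blast
    \<comment> \<open>Positions increase strictly but stay below the current target, so no target
      remains in force forever.\<close>
    have "\<exists>m. idx (n + m) \<noteq> Suc i"
    proof (rule ccontr)
      assume "\<not> ?thesis"
      then have "p (n + m) < c (Suc i)" for m using less[of "n + m"] by simp
      moreover have "n + m \<le> p (n + m)" for m using strict_mono_imp_increasing[OF mono] .
      ultimately show False by (meson le_add2 le_less_trans less_irrefl)
    qed
    then have ex: "\<exists>m. idx (n + m) \<noteq> Suc i" .
    define m where "m = (LEAST m. idx (n + m) \<noteq> Suc i)"
    have m: "idx (n + m) \<noteq> Suc i" unfolding m_def by (rule LeastI_ex[OF ex])
    then obtain k where k: "m = Suc k" using n by (cases m) auto
    then have "idx (n + k) = Suc i" using not_less_Least[of k "\<lambda>m. idx (n + m) \<noteq> Suc i"]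
      by (auto simp: m_def[symmetric])
    then show ?case using step(2)[of "n + k"] m k by (intro exI[of _ "n + m"]) auto
  qed
  show ?thesis
    using step(1) reach by (intro exI[of _ p]) (auto, metis rangeI)
qed

lemma desc_imp_path:
  assumes "m \<in> desc s u"
  shows "(u, m) \<in> ((parcs (hist_graph s UNIV))\<inverse>)\<^sup>*"
  using assms
proof induction
  case (par1 k)
  then have "(par1 s k, k) \<in> (parcs (hist_graph s UNIV))\<inverse>" by (auto simp: parcs_hist_graph)
  with par1 show ?case by (meson rtrancl.rtrancl_into_rtrancl)
next
  case (par2 k)
  then have "(par2 s k, k) \<in> (parcs (hist_graph s UNIV))\<inverse>" by (auto simp: parcs_hist_graph)
  with par2 show ?case by (meson rtrancl.rtrancl_into_rtrancl)
qed simp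

lemma one_ended_hist_graph:
  assumes less: "\<And>k. 1 \<le> k \<Longrightarrow> par1 s k < k \<and> par2 s k < k"
    and cofinite: "\<And>u. \<exists>a. \<forall>m>a. m \<in> desc s u"
  shows "one_ended (hist_graph s UNIV)"
proof -
  let ?G = "hist_graph s UNIV"
  have arc: "v < k" if "(k, v) \<in> parcs ?G" for k v using that less by (auto simp: parcs_hist_graph)
  \<comment> \<open>Arcs lower the label, so a ray cannot follow them forever.\<close>
  have up: "\<forall>i. (r (Suc i), r i) \<in> parcs ?G" if "ray ?G r" for r
  proof (rule ccontr)
    assume "\<not> ?thesis"
    then have "(r i, r (Suc i)) \<in> parcs ?G" for i using that unfolding ray_def by blast
    then have "r (Suc i) < r i" for i using arc by blast
    then show False using wf_less unfolding wf_iff_no_infinite_down_chain by blast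
  qed
  have onward: "\<exists>w\<in>range r. (u, w) \<in> ((parcs ?G)\<inverse>)\<^sup>+" if "ray ?G r" for r u
  proof -
    have "strict_mono r" using up[OF that] arc by (auto intro: strict_mono_Suc_iff[THEN iffD2])
    then have ge: "i \<le> r i" for i by (rule strict_mono_imp_increasing)
    obtain a where a: "\<forall>m>a. m \<in> desc s u" using cofinite by blast
    define w where "w = r (Suc (max a u))"
    have "a < w" "u < w" using ge[of "Suc (max a u)"] unfolding w_def by auto
    then have "(u, w) \<in> ((parcs ?G)\<inverse>)\<^sup>+" using desc_imp_path[of w s u] a by (auto simp: rtrancl_eq_or_trancl)
    then show ?thesis unfolding w_def by blast
  qed
  show ?thesis unfolding one_ended_def
  proof (intro allI impI)
    fix r1 r2 assume r: "ray ?G r1" "ray ?G r2"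
    \<comment> \<open>Even indices aim at \<open>r1\<close>, odd ones at \<open>r2\<close>; a path
      through these targets is the third ray.\<close>
    define tgt where "tgt i = (if even i then r1 else r2)" for i :: nat
    have "\<exists>c. \<forall>i. c i \<in> range (tgt i) \<and> (c i, c (Suc i)) \<in> ((parcs ?G)\<inverse>)\<^sup>+"
    proof (rule dependent_nat_choice)
      show "\<exists>w. w \<in> range (tgt 0)" by blast
      show "\<exists>w. w \<in> range (tgt (Suc i)) \<and> (v, w) \<in> ((parcs ?G)\<inverse>)\<^sup>+" for v i
      proof -
        have "ray ?G (tgt (Suc i))" using r by (simp add: tgt_def)
        then show ?thesis using onward by blast
      qed
    qed
    then obtain c where c: "\<And>i. c i \<in> range (tgt i)" "\<And>i. (c i, c (Suc i)) \<in> ((parcs ?G)\<inverse>)\<^sup>+" by blast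
    obtain p where p: "\<And>n. (p n, p (Suc n)) \<in> (parcs ?G)\<inverse>" "range c \<subseteq> range p"
      using path_through[of c "(parcs ?G)\<inverse>"] c(2) arc by blast
    have "c i < c (Suc i)" for i
    proof -
      have "u < v" if "(u, v) \<in> ((parcs ?G)\<inverse>)\<^sup>+" for u v
        using that by induction (use arc less_trans in blast)+
      then show ?thesis using c(2) by blast
    qed
    then have "strict_mono c" by (auto intro: strict_mono_Suc_iff[THEN iffD2])
    then have inj: "inj c" by (rule strict_mono_imp_inj_on)
    have "infinite (c ` {i. even i = b})" for b
    proof (subst finite_image_iff)
      show "inj_on c {i. even i = b}" using inj by (rule inj_on_subset) simp
      have "m \<le> 2 * m + (if b then 0 else 1) \<and> even (2 * m + (if b then 0 else 1)) = b" for m :: nat by simp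
      then show "infinite {i::nat. even i = b}" unfolding infinite_nat_iff_unbounded_le by blast
    qed
    moreover have "c ` {i. even i = b} \<subseteq> range p \<inter> range (if b then r1 else r2)" for b
    proof
      fix w assume "w \<in> c ` {i. even i = b}"
      then obtain i where i: "w = c i" "even i = b" by blast
      then have "w \<in> range (if b then r1 else r2)" using c(1)[of i] by (simp add: tgt_def)
      moreover have "w \<in> range p" using i(1) p(2) by blast
      ultimately show "w \<in> range p \<inter> range (if b then r1 else r2)" by blast
    qed
    ultimately have "infinite (range p \<inter> range (if b then r1 else r2))" for b
      by (meson infinite_super)
    from this[of True] this[of False]
    have "infinite (range p \<inter> range r1)" "infinite (range p \<inter> range r2)" by simp_all
    moreover have "ray ?G p" using p(1) by (auto simp: ray_def)
    ultimately show "ray_equiv ?G r1 r2" unfolding ray_equiv_def by blast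
  qed
qed

context delay_bounds
begin

lemma tangle_limit_one_ended:
  assumes s: "s = (\<lambda>k. (\<Theta> k \<omega>, \<epsilon> k \<omega>, X k \<omega>, Y k \<omega>))" and valid: "\<And>n. valid s n"
    and cofinite: "\<And>u. \<exists>a. \<forall>m>a. m \<in> desc s u"
  shows "limitin dag_metric.mtopology (\<lambda>n. tangle \<Theta> X Y \<omega> (int n)) (tangle_union \<Theta> X Y \<omega>) sequentially
    \<and> one_ended (tangle_union \<Theta> X Y \<omega>)"
proof -
  let ?G = "hist_graph s UNIV"
  have tangle: "tangle \<Theta> X Y \<omega> (int n) = hist_graph s (landed s n)" for n
    using tangle_eq[of \<Theta> X Y \<omega> n 0 \<epsilon>] by (simp add: s)
  have union: "tangle_union \<Theta> X Y \<omega> = ?G"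
  proof -
    have "k \<in> landed s (Suc (k + dur s k))" for k by (auto simp: landed_def)
    then have "\<exists>i\<in>{1..}. k \<in> landed s i" for k
      by (intro bexI[of _ "Suc (k + dur s k)"]) auto
    then show ?thesis
      unfolding tangle_union_def tangle hist_graph_def by auto
  qed
  have less: "par1 s k < k \<and> par2 s k < k" if "1 \<le> k" for k
    using valid_par_less[OF valid, of k k] that by simp
  have bounds: "dur s k \<le> H" "lag s k \<le> J" "par1 s k \<in> tip_set s (k - lag s k)"
    "par2 s k \<in> tip_set s (k - lag s k)" if "1 \<le> k" for k
    using valid[of k] that by (auto simp: valid_def)
  have landed_mono: "landed s t \<subseteq> landed s t'" if "t \<le> t'" for t t' using that by (auto simp: landed_def)
  have finite_children: "finite {k. 1 \<le> k \<and> (par1 s k = v \<or> par2 s k = v)}" for v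
  proof -
    \<comment> \<open>Without a child, \<open>v\<close> would be its own only descendant.\<close>
    have "\<exists>k\<ge>1. par1 s k = v \<or> par2 s k = v"
    proof (rule ccontr)
      assume no: "\<not> ?thesis"
      have "m = v" if "m \<in> desc s v" for m
        using that
      proof induction
        case (par1 k)
        then show ?case using no by (auto dest: spec[of _ k])
      next
        case (par2 k)
        then show ?case using no by (auto dest: spec[of _ k])
      qed simp
      then show False using cofinite[of v] by (metis gt_ex less_irrefl max_less_iff_conj)
    qed
    then obtain k where k: "1 \<le> k" "par1 s k = v \<or> par2 s k = v" by blast
    \<comment> \<open>Once an arc into \<open>v\<close> is visible, \<open>v\<close> is never a tip
      again, and later vertices look back at most \<open>J\<close> steps.\<close>
    have "m \<le> k + dur s k + J" if m: "1 \<le> m" "par1 s m = v \<or> par2 s m = v" for m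
    proof (rule ccontr)
      assume "\<not> ?thesis"
      then have "k + dur s k < m - lag s m" using bounds(2)[OF m(1)] by auto
      then show False using k m bounds(3,4)[OF m(1)] by (auto simp: tip_set_def)
    qed
    then have "{k. 1 \<le> k \<and> (par1 s k = v \<or> par2 s k = v)} \<subseteq> {..k + dur s k + J}" by auto
    then show ?thesis by (rule finite_subset) simp
  qed
  have G: "?G \<in> dag_space"
    by (rule hist_graph_in_dag_space) (use less finite_children in auto)
  have Gn: "hist_graph s (landed s n) \<in> dag_space" for n
  proof (rule hist_graph_in_dag_space)
    show "par1 s k \<in> landed s n \<and> par2 s k \<in> landed s n" if "k \<in> landed s n" "1 \<le> k" for k
    proof -
      have "k - lag s k \<le> n" using that by (auto simp: landed_def)
      then show ?thesis using bounds(3,4)[OF that(2)] landed_mono[of "k - lag s k" n]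
        by (auto simp: tip_set_def)
    qed
    show "finite {k \<in> landed s n. 1 \<le> k \<and> (par1 s k = v \<or> par2 s k = v)}" for v by simp
    show "0 \<in> landed s n" by (simp add: landed_def)
  qed (use less in blast)
  have wf: "pair_wf_digraph K" if "K \<in> dag_space" for K using that by (simp add: dag_space_def)
  have "eventually (\<lambda>n. root_ball r (hist_graph s (landed s n)) = root_ball r ?G) sequentially" for r
  proof -
    \<comment> \<open>The limit ball is finite, so after some time all its vertices have landed with
      their arcs.\<close>
    have "bdd_above ((\<lambda>k. k + dur s k) ` ball_verts r ?G)"
      using finite_ball_verts[OF G, of r] by simp
    then obtain b where b: "\<And>k. k \<in> ball_verts r ?G \<Longrightarrow> k + dur s k \<le> b" by (auto simp: bdd_above_def)
    have "root_ball r (hist_graph s (landed s n)) = root_ball r ?G" if "Suc b \<le> n" for n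
    proof (rule root_ball_subgraph[OF wf[OF Gn] wf[OF G]])
      have "k \<in> landed s n" if "k \<in> ball_verts r ?G" for k
        using b[OF that] \<open>Suc b \<le> n\<close> by (auto simp: landed_def)
      then show "Restr (parcs ?G) (ball_verts r ?G) \<subseteq> parcs (hist_graph s (landed s n))"
        by (auto simp: parcs_hist_graph)
      show "parcs (hist_graph s (landed s n)) \<subseteq> parcs ?G" by (auto simp: parcs_hist_graph)
      show "0 \<in> pverts (hist_graph s (landed s n))" by (simp add: landed_def)
    qed simp
    then show ?thesis unfolding eventually_sequentially by blast
  qed
  then have "limitin dag_metric.mtopology (\<lambda>n. hist_graph s (landed s n)) ?G sequentially"
    by (intro limitin_dag_spaceI Gn G)
  moreover have "one_ended ?G" by (rule one_ended_hist_graph[OF less cofinite])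
  ultimately show ?thesis unfolding union tangle ..
qed

end


section \<open>Almost sure occurrence of long runs\<close>

context tangle_model
begin

interpretation delay_bounds "h M" "Max I" .

definition hist :: "'o \<Rightarrow> history" where
  "hist \<omega> = (\<lambda>k. (\<Theta> k \<omega>, \<epsilon> k \<omega>, X k \<omega>, Y k \<omega>))"

abbreviation past :: "nat \<Rightarrow> 'o measure" where
  "past n \<equiv> past_algebra P {\<Theta>, \<epsilon>, X, Y} n"

section \<open>Measurability with respect to the past\<close>

lemma past_generators:
  "{Z m -` A \<inter> space P |Z m A. Z \<in> {\<Theta>, \<epsilon>, X, Y} \<and> m \<in> {1..n}} \<subseteq> Pow (space P)"
  by auto

lemma space_past [simp]: "space (past n) = space P"
  unfolding past_algebra_def by (rule space_measure_of[OF past_generators])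

lemma subalgebra_past: "subalgebra P (past n)"
proof -
  have "sets (past n) = sigma_sets (space P)
      {Z m -` A \<inter> space P |Z m A. Z \<in> {\<Theta>, \<epsilon>, X, Y} \<and> m \<in> {1..n}}"
    unfolding past_algebra_def by (rule sets_measure_of[OF past_generators])
  also have "\<dots> \<subseteq> sets P"
  proof (rule sets.sigma_sets_subset, clarify)
    fix Z m A assume "Z \<in> {\<Theta>, \<epsilon>, X, Y}" "m \<in> {1..n}"
    then have "random_variable (count_space UNIV) (Z m)" by (intro random_variables) auto
    then show "Z m -` A \<inter> space P \<in> sets P" by (rule measurable_sets) simp
  qed
  finally show ?thesis by (simp add: subalgebra_def)
qed

interpretation past: finite_measure_subalgebra P "past n" for n
  by unfold_locales (rule subalgebra_past)

lemma coordinate_measurable: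
  assumes "Z \<in> {\<Theta>, \<epsilon>, X, Y}" "m \<in> {1..n}"
  shows "Z m \<in> measurable (past n) (count_space UNIV)"
proof (rule measurableI)
  fix A
  have "Z m -` A \<inter> space P \<in> sets (past n)"
    unfolding past_algebra_def sets_measure_of[OF past_generators] using assms by blast
  then show "Z m -` A \<inter> space (past n) \<in> sets (past n)" by simp
qed simp

lemma hist_measurable:
  assumes "m \<in> {1..n}"
  shows "(\<lambda>\<omega>. hist \<omega> m) \<in> measurable (past n) (count_space UNIV)"
proof -
  note [measurable] = coordinate_measurable[OF _ assms, of \<Theta>, simplified]
    coordinate_measurable[OF _ assms, of \<epsilon>, simplified]
    coordinate_measurable[OF _ assms, of X, simplified]
    coordinate_measurable[OF _ assms, of Y, simplified]
  show ?thesis unfolding hist_def by measurable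
qed

text \<open>\<open>f\<close> factors through the list of the first \<open>n\<close> entries, whose
  type is countable; every function on it is measurable, so nothing about the structure of
  \<open>f\<close> has to be analysed.\<close>

lemma history_functional_measurable:
  assumes dep: "\<And>s s'. \<forall>k\<in>{1..n}. s k = s' k \<Longrightarrow> f s = f s'" and range: "\<And>s. f s \<in> space N"
  shows "(\<lambda>\<omega>. f (hist \<omega>)) \<in> measurable (past n) N"
proof -
  define l where "l \<omega> = map (hist \<omega>) [1..<Suc n]" for \<omega>
  have "l \<in> measurable (past n) (count_space UNIV)"
    unfolding measurable_count_space_eq2_countable
  proof (intro conjI ballI)
    fix xs :: "(nat \<times> nat \<times> nat \<times> nat) list"
    note [measurable] = hist_measurable
    have l_length: "length (l \<omega>) = n" and l_nth: "i < n \<Longrightarrow> l \<omega> ! i = hist \<omega> (Suc i)" for \<omega> i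
      by (simp_all add: l_def del: upt_Suc)
    have "l \<omega> = xs \<longleftrightarrow> length xs = n \<and> (\<forall>k\<in>{1..n}. hist \<omega> k = xs ! (k - 1))" for \<omega>
    proof
      assume "length xs = n \<and> (\<forall>k\<in>{1..n}. hist \<omega> k = xs ! (k - 1))"
      then show "l \<omega> = xs" by (intro nth_equalityI) (simp_all add: l_length l_nth)
    qed (auto simp: l_length l_nth)
    then have "l -` {xs} \<inter> space (past n) =
      {\<omega> \<in> space (past n). length xs = n \<and> (\<forall>k\<in>{1..n}. hist \<omega> k = xs ! (k - 1))}" by blast
    also have "\<dots> \<in> sets (past n)" by measurable
    finally show "l -` {xs} \<inter> space (past n) \<in> sets (past n)" .
  qed simp
  moreover have "(\<lambda>xs. f (\<lambda>k. xs ! (k - 1))) \<in> measurable (count_space UNIV) N" using range by simp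
  ultimately have "(\<lambda>\<omega>. f (\<lambda>k. l \<omega> ! (k - 1))) \<in> measurable (past n) N" by (rule measurable_compose)
  \<comment> \<open>The list rebuilds the history on \<open>{1..n}\<close> only; \<open>dep\<close>
    makes the other entries harmless.\<close>
  moreover have "f (\<lambda>k. l \<omega> ! (k - 1)) = f (hist \<omega>)" for \<omega>
    by (rule dep) (auto simp: l_def simp del: upt_Suc)
  ultimately show ?thesis by simp
qed

lemma history_functional_measurable_P:
  assumes "\<And>s s'. \<forall>k\<in>{1..n}. s k = s' k \<Longrightarrow> f s = f s'" "\<And>s. f s \<in> space N"
  shows "(\<lambda>\<omega>. f (hist \<omega>)) \<in> measurable P N"
  using measurable_from_subalg[OF subalgebra_past history_functional_measurable[of n f N]] assms by blast

definition outcome :: "nat \<Rightarrow> nat \<times> nat \<times> nat \<times> nat \<Rightarrow> 'o set" where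
  "outcome n z = {\<omega> \<in> space P. hist \<omega> n = z}"

lemma outcome_sets [measurable]: "outcome (Suc n) z \<in> sets P"
proof -
  have [measurable]: "(\<lambda>\<omega>. hist \<omega> (Suc n)) \<in> measurable P (count_space UNIV)"
    by (rule measurable_from_subalg[OF subalgebra_past[of "Suc n"] hist_measurable]) simp
  show ?thesis unfolding outcome_def by measurable
qed

section \<open>The conditional law of one step\<close>

lemma step_law:
  assumes "k \<in> {1..M}" "j \<in> I"
  shows "AE \<omega> in P. real_cond_exp P (past n) (indicator (outcome (Suc n) (h k, j, v, v'))) \<omega> =
    (let T = tip_set (hist \<omega>) (Suc n - j)
     in p\<^sub>\<Theta> k * p\<^sub>\<epsilon> j / (real (card T))\<^sup>2 * of_bool (v \<in> T \<and> v' \<in> T))"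
proof -
  have "tips (tangle \<Theta> X Y \<omega> (int (Suc n) - int j)) = tip_set (hist \<omega>) (Suc n - j)" for \<omega>
    unfolding tangle_eq[of \<Theta> X Y \<omega> "Suc n" j \<epsilon>] hist_def tips_hist_graph ..
  moreover have "{\<omega> \<in> space P. \<Theta> (Suc n) \<omega> = h k \<and> \<epsilon> (Suc n) \<omega> = j \<and> X (Suc n) \<omega> = v \<and> Y (Suc n) \<omega> = v'}
      = outcome (Suc n) (h k, j, v, v')"
    by (auto simp: outcome_def hist_def)
  ultimately show ?thesis
    using conditional_law[of "Suc n" k j v v'] assms by simp
qed

text \<open>On the past event that one of the parents is not an available tip, the conditional
  probability of the outcome vanishes; integrating over that event shows that both occur together
  with probability 0.\<close>

lemma AE_parents_are_tips:
  assumes "k \<in> {1..M}" "j \<in> I"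
  shows "AE \<omega> in P. hist \<omega> (Suc n) = (h k, j, v, v') \<longrightarrow>
    v \<in> tip_set (hist \<omega>) (Suc n - j) \<and> v' \<in> tip_set (hist \<omega>) (Suc n - j)"
proof -
  define bad where "bad s \<longleftrightarrow> \<not> (v \<in> tip_set s (Suc n - j) \<and> v' \<in> tip_set s (Suc n - j))" for s
  define A where "A = outcome (Suc n) (h k, j, v, v')"
  define B where "B = {\<omega> \<in> space P. bad (hist \<omega>)}"
  have "Measurable.pred (past n) (\<lambda>\<omega>. bad (hist \<omega>))"
  proof (rule history_functional_measurable)
    show "bad s = bad s'" if "\<forall>k\<in>{1..n}. s k = s' k" for s s'
      unfolding bad_def tip_set_cong[OF that, of "Suc n - j", simplified] ..
  qed simp
  then have B: "B \<in> sets (past n)" by (simp add: B_def Measurable.pred_def)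
  then have BP: "B \<in> sets P" using subalgebra_past[of n] by (auto simp: subalgebra_def)
  have A: "A \<in> sets P" unfolding A_def by simp
  have "(\<integral>\<omega>. indicator B \<omega> * real_cond_exp P (past n) (indicator A) \<omega> \<partial>P)
      = (\<integral>\<omega>. indicator B \<omega> * indicator A \<omega> \<partial>P)"
  proof (rule past.real_cond_exp_intg(2))
    show "integrable P (\<lambda>\<omega>. indicator B \<omega> * indicator A \<omega> :: real)"
      using A BP by (simp add: indicator_inter_arith[symmetric] emeasure_eq_measure)
  qed (use A B in auto)
  also have "(\<lambda>\<omega>. indicator B \<omega> * indicator A \<omega> :: real) = indicator (B \<inter> A)"
    by (simp add: indicator_inter_arith fun_eq_iff)
  also have "(\<integral>\<omega>. indicator B \<omega> * real_cond_exp P (past n) (indicator A) \<omega> \<partial>P) = (\<integral>\<omega>. 0 \<partial>P)"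
  proof (rule integral_cong_AE)
    show "AE \<omega> in P. indicator B \<omega> * real_cond_exp P (past n) (indicator A) \<omega> = 0"
      using step_law[OF assms, of n v v'] unfolding A_def[symmetric]
      by eventually_elim (auto simp: B_def bad_def indicator_def Let_def)
  qed (use BP in auto)
  finally have "prob (B \<inter> A) = 0" using A BP by simp
  then have "AE \<omega> in P. \<omega> \<notin> B \<inter> A" using A BP by (simp add: prob_eq_0)
  then show ?thesis using AE_space
    by eventually_elim (auto simp: A_def B_def bad_def outcome_def)
qed

lemma h_le: "k \<in> {1..M} \<Longrightarrow> h k \<le> h M"
  using strict_mono_on_leD[OF h_strict_mono, of k M] M_ge_1 by auto

lemma AE_valid: "AE \<omega> in P. \<forall>n. valid (hist \<omega>) n"
proof -
  have "AE \<omega> in P. \<forall>n. \<forall>k\<in>{1..M}. \<forall>j\<in>I. \<forall>v v'. hist \<omega> (Suc n) = (h k, j, v, v') \<longrightarrow>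
    v \<in> tip_set (hist \<omega>) (Suc n - j) \<and> v' \<in> tip_set (hist \<omega>) (Suc n - j)"
    unfolding AE_all_countable
    using I_finite by (auto intro!: AE_parents_are_tips AE_finite_allI simp: AE_all_countable)
  then show ?thesis using AE_space
  proof eventually_elim
    case (elim \<omega>)
    have "dur (hist \<omega>) m \<le> h M \<and> lag (hist \<omega>) m \<le> Max I \<and>
      par1 (hist \<omega>) m \<in> tip_set (hist \<omega>) (m - lag (hist \<omega>) m) \<and>
      par2 (hist \<omega>) m \<in> tip_set (hist \<omega>) (m - lag (hist \<omega>) m)" if m: "1 \<le> m" for m
    proof -
      obtain n where n: "m = Suc n" using m by (cases m) auto
      obtain k where k: "k \<in> {1..M}" "\<Theta> m \<omega> = h k" using \<Theta>_range[OF m elim(2)] by blast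
      have j: "\<epsilon> m \<omega> \<in> I" by (rule \<epsilon>_range[OF m elim(2)])
      have "hist \<omega> (Suc n) = (h k, \<epsilon> m \<omega>, X m \<omega>, Y m \<omega>)" using k by (simp add: hist_def n)
      then have "X m \<omega> \<in> tip_set (hist \<omega>) (m - \<epsilon> m \<omega>) \<and> Y m \<omega> \<in> tip_set (hist \<omega>) (m - \<epsilon> m \<omega>)"
        using elim(1) k(1) j n by metis
      then show ?thesis using h_le[OF k(1)] k(2) j I_finite by (simp add: hist_def)
    qed
    then show ?case by (simp add: valid_def)
  qed
qed

text \<open>From \<open>u + h M + Max I\<close> on, \<open>u\<close> has landed in every view that a
  new vertex can have, as \<open>potential_drift\<close> requires; earlier runs are ignored.\<close>

definition pending :: "nat \<Rightarrow> history \<Rightarrow> nat \<Rightarrow> bool" where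
  "pending u s n \<longleftrightarrow> (\<forall>m\<in>{u + h M + Max I..n}. run u s m < run_goal)"

lemma pending_cong:
  assumes "\<forall>k\<in>{1..n}. s k = s' k"
  shows "pending u s n = pending u s' n"
proof -
  have "run u s m = run u s' m" if "m \<le> n" for m
    by (rule run_cong) (use assms that in auto)
  then show ?thesis by (auto simp: pending_def)
qed

section \<open>Drift in expectation and completion of a run\<close>

lemma pending_measurable [measurable]: "Measurable.pred P (\<lambda>\<omega>. pending u (hist \<omega>) n)"
  by (rule history_functional_measurable_P[of n]) (erule pending_cong, simp)

lemma potential_measurable [measurable]: "(\<lambda>\<omega>. potential u (hist \<omega>) n) \<in> borel_measurable P"
  by (rule history_functional_measurable_P[of n]) (erule potential_cong, simp)

lemma integrable_potential:
  "integrable P (\<lambda>\<omega>. of_bool (pending u (hist \<omega>) n') * potential u (hist \<omega>) n)"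
proof (rule integrable_const_bound[where B = "real (Suc n) + run_reward run_goal"])
  show "AE \<omega> in P. norm (of_bool (pending u (hist \<omega>) n') * potential u (hist \<omega>) n)
      \<le> real (Suc n) + run_reward run_goal"
    using potential_le potential_nonneg by (auto simp: of_bool_def intro!: AE_I2 add_nonneg_nonneg)
qed simp

text \<open>On each of finitely many outcomes of the next step, the new potential is a
  past-measurable factor; under the integral the indicator of the outcome may be replaced by its
  conditional probability. Then \<open>potential_drift\<close> applies for each duration and lag,
  with weights summing to one.\<close>

lemma expected_drift:
  assumes n: "u + h M + Max I \<le> n"
  shows "(\<integral>\<omega>. of_bool (pending u (hist \<omega>) n) * potential u (hist \<omega>) (Suc n) \<partial>P)
    \<le> (\<integral>\<omega>. of_bool (pending u (hist \<omega>) n) * potential u (hist \<omega>) n \<partial>P)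
      - prob {\<omega> \<in> space P. pending u (hist \<omega>) n} / 2"
proof -
  \<comment> \<open>Parents of a valid vertex \<open>Suc n\<close> are at most \<open>n\<close>, so
    this finite set almost surely contains the outcome.\<close>
  define S where "S = {1..M} \<times> I \<times> {..n} \<times> {..n}"
  have [simp]: "finite S" using I_finite by (simp add: S_def)
  define ev where "ev = (\<lambda>(k, j, v, v'). outcome (Suc n) (h k, j, v, v'))"
  \<comment> \<open>Overwriting entry \<open>Suc n\<close> turns the next potential into a
    functional of the first \<open>n\<close> entries.\<close>
  define V where "V = (\<lambda>(k, j, v, v') s. of_bool (pending u s n) *
    potential u (s(Suc n := (h k, j, v, v'))) (Suc n))"
  define ce where "ce z = real_cond_exp P (past n) (indicator (ev z))" for z
  have V_meas: "(\<lambda>\<omega>. V z (hist \<omega>)) \<in> borel_measurable (past n)" for z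
  proof (rule history_functional_measurable)
    fix s s' :: history assume ag: "\<forall>k\<in>{1..n}. s k = s' k"
    obtain k j v v' where z: "z = (k, j, v, v')" by (cases z)
    have "potential u (s(Suc n := (h k, j, v, v'))) (Suc n) = potential u (s'(Suc n := (h k, j, v, v'))) (Suc n)"
      by (rule potential_cong) (use ag in auto)
    then show "V z s = V z s'" using pending_cong[OF ag] by (simp add: V_def z)
  qed simp
  have V_meas_P [measurable]: "(\<lambda>\<omega>. V z (hist \<omega>)) \<in> borel_measurable P" for z
    by (rule measurable_from_subalg[OF subalgebra_past V_meas])
  have ev_sets [measurable]: "ev z \<in> sets P" for z by (simp add: ev_def split: prod.split)
  have V_bound: "norm (V z s) \<le> real (Suc (Suc n)) + run_reward run_goal" for z s
    using potential_le[of u "s(Suc n := y)" "Suc n" for y] potential_nonneg[of u "s(Suc n := y)" "Suc n" for y]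
    by (auto simp: V_def of_bool_def add_nonneg_nonneg split: prod.split)
  have int: "integrable P (\<lambda>\<omega>. V z (hist \<omega>) * indicator (ev z) \<omega>)" for z
  proof (rule integrable_const_bound[where B = "real (Suc (Suc n)) + run_reward run_goal"])
    show "AE \<omega> in P. norm (V z (hist \<omega>) * indicator (ev z) \<omega>) \<le> real (Suc (Suc n)) + run_reward run_goal"
      using V_bound by (intro AE_I2) (auto simp: indicator_def add_nonneg_nonneg)
  qed simp
  have intce: "integrable P (\<lambda>\<omega>. V z (hist \<omega>) * ce z \<omega>)"
    and ce: "(\<integral>\<omega>. V z (hist \<omega>) * ce z \<omega> \<partial>P) = (\<integral>\<omega>. V z (hist \<omega>) * indicator (ev z) \<omega> \<partial>P)" for z
    unfolding ce_def by (rule past.real_cond_exp_intg[OF int V_meas], simp)+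
  have "(\<integral>\<omega>. of_bool (pending u (hist \<omega>) n) * potential u (hist \<omega>) (Suc n) \<partial>P)
      = (\<integral>\<omega>. (\<Sum>z\<in>S. V z (hist \<omega>) * indicator (ev z) \<omega>) \<partial>P)"
  proof (rule integral_cong_AE)
    show "AE \<omega> in P. of_bool (pending u (hist \<omega>) n) * potential u (hist \<omega>) (Suc n)
        = (\<Sum>z\<in>S. V z (hist \<omega>) * indicator (ev z) \<omega>)"
      using AE_valid AE_space
    proof eventually_elim
      case (elim \<omega>)
      obtain k where k: "k \<in> {1..M}" "\<Theta> (Suc n) \<omega> = h k" using \<Theta>_range[OF _ elim(2), of "Suc n"] by auto
      define z where "z = (k, \<epsilon> (Suc n) \<omega>, X (Suc n) \<omega>, Y (Suc n) \<omega>)"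
      have "X (Suc n) \<omega> < Suc n" "Y (Suc n) \<omega> < Suc n"
        using valid_par_less[OF elim(1)[rule_format], of "Suc n" "Suc n"] by (simp_all add: hist_def)
      then have z: "z \<in> S" using k \<epsilon>_range[OF _ elim(2), of "Suc n"] by (simp add: z_def S_def)
      have "indicator (ev z') \<omega> = (of_bool (z' = z) :: real)" if "z' \<in> S" for z'
      proof -
        obtain k' j v v' where z': "z' = (k', j, v, v')" by (cases z')
        then have "h k' = h k \<longleftrightarrow> k' = k"
          using that k(1) strict_mono_on_imp_inj_on[OF h_strict_mono] by (auto simp: S_def inj_on_eq_iff)
        then show ?thesis
          using k(2) elim(2) by (auto simp: z' ev_def outcome_def hist_def z_def indicator_def)
      qed
      then have "(\<Sum>z'\<in>S. V z' (hist \<omega>) * indicator (ev z') \<omega>) = (\<Sum>z'\<in>S. if z' = z then V z' (hist \<omega>) else 0)"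
        by (intro sum.cong) auto
      also have "\<dots> = V z (hist \<omega>)" using z by simp
      also have "\<dots> = of_bool (pending u (hist \<omega>) n) * potential u (hist \<omega>) (Suc n)"
      proof -
        have "(hist \<omega>)(Suc n := (h k, \<epsilon> (Suc n) \<omega>, X (Suc n) \<omega>, Y (Suc n) \<omega>)) = hist \<omega>"
          using k by (auto simp: hist_def)
        then show ?thesis by (simp add: V_def z_def)
      qed
      finally show ?case ..
    qed
    show "(\<lambda>\<omega>. \<Sum>z\<in>S. V z (hist \<omega>) * indicator (ev z) \<omega>) \<in> borel_measurable P" by measurable
  qed simp
  also have "\<dots> = (\<integral>\<omega>. (\<Sum>z\<in>S. V z (hist \<omega>) * ce z \<omega>) \<partial>P)"
    unfolding Bochner_Integration.integral_sum[OF int] Bochner_Integration.integral_sum[OF intce] ce ..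
  also have "\<dots> \<le> (\<integral>\<omega>. of_bool (pending u (hist \<omega>) n) * potential u (hist \<omega>) n
      - of_bool (pending u (hist \<omega>) n) / 2 \<partial>P)"
  proof (rule integral_mono_AE)
    show "integrable P (\<lambda>\<omega>. \<Sum>z\<in>S. V z (hist \<omega>) * ce z \<omega>)" using intce by simp
    show "integrable P (\<lambda>\<omega>. of_bool (pending u (hist \<omega>) n) * potential u (hist \<omega>) n
      - of_bool (pending u (hist \<omega>) n) / 2)"
      by (intro Bochner_Integration.integrable_diff integrable_potential
          integrable_const_bound[where B = 1]) auto
    have "AE \<omega> in P. \<forall>z\<in>S. ce z \<omega> = (case z of (k, j, v, v') \<Rightarrow>
       let T = tip_set (hist \<omega>) (Suc n - j)
       in p\<^sub>\<Theta> k * p\<^sub>\<epsilon> j / (real (card T))\<^sup>2 * of_bool (v \<in> T \<and> v' \<in> T))"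
    proof (rule AE_finite_allI)
      fix z assume "z \<in> S"
      then obtain k j v v' where z: "z = (k, j, v, v')" "k \<in> {1..M}" "j \<in> I" by (auto simp: S_def)
      show "AE \<omega> in P. ce z \<omega> = (case z of (k, j, v, v') \<Rightarrow>
         let T = tip_set (hist \<omega>) (Suc n - j)
         in p\<^sub>\<Theta> k * p\<^sub>\<epsilon> j / (real (card T))\<^sup>2 * of_bool (v \<in> T \<and> v' \<in> T))"
        using step_law[OF z(2,3), of n v v'] by (simp only: z(1) ce_def ev_def prod.case)
    qed simp
    then show "AE \<omega> in P. (\<Sum>z\<in>S. V z (hist \<omega>) * ce z \<omega>)
      \<le> of_bool (pending u (hist \<omega>) n) * potential u (hist \<omega>) n - of_bool (pending u (hist \<omega>) n) / 2"
      using AE_valid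
    proof eventually_elim
      case (elim \<omega>)
      show ?case
      proof (cases "pending u (hist \<omega>) n")
        case False
        then show ?thesis by (simp add: V_def case_prod_unfold)
      next
        case True
        then have unfinished: "run u (hist \<omega>) n < run_goal" using n by (auto simp: pending_def)
        define s where "s = hist \<omega>"
        define T where "T j = tip_set s (Suc n - j)" for j
        have valid: "valid s n" using elim(2) by (simp add: s_def)
        have T_sub: "T j \<subseteq> {..n}" for j
          using tip_set_less[of _ s "Suc n - j" "Suc n"] by (auto simp: T_def less_Suc_eq_le)
        let ?V = "\<lambda>k j v v'. potential u (s(Suc n := (h k, j, v, v'))) (Suc n)"
        have "(\<Sum>z\<in>S. V z (hist \<omega>) * ce z \<omega>) = (\<Sum>(k, j, v, v')\<in>S.
            ?V k j v v' * (p\<^sub>\<Theta> k * p\<^sub>\<epsilon> j / (real (card (T j)))\<^sup>2 * of_bool (v \<in> T j \<and> v' \<in> T j)))"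
          using elim(1) True by (intro sum.cong) (auto simp: V_def s_def T_def Let_def)
        also have "\<dots> = (\<Sum>k\<in>{1..M}. \<Sum>j\<in>I. \<Sum>v\<le>n. \<Sum>v'\<le>n.
            ?V k j v v' * (p\<^sub>\<Theta> k * p\<^sub>\<epsilon> j / (real (card (T j)))\<^sup>2 * of_bool (v \<in> T j \<and> v' \<in> T j)))"
          by (simp add: S_def sum.cartesian_product)
        also have "\<dots> = (\<Sum>k\<in>{1..M}. \<Sum>j\<in>I. p\<^sub>\<Theta> k * p\<^sub>\<epsilon> j / (real (card (T j)))\<^sup>2 *
            (\<Sum>v\<in>T j. \<Sum>v'\<in>T j. ?V k j v v'))"
        proof (intro sum.cong refl)
          fix k j
          have "(\<Sum>v\<le>n. \<Sum>v'\<le>n. ?V k j v v' * (c * of_bool (v \<in> T j \<and> v' \<in> T j)))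
            = (\<Sum>v\<in>T j. \<Sum>v'\<in>T j. c * ?V k j v v')" for c :: real
          proof -
            have "(\<Sum>v\<in>T j. \<Sum>v'\<in>T j. c * ?V k j v v')
              = (\<Sum>v\<in>T j. \<Sum>v'\<le>n. ?V k j v v' * (c * of_bool (v \<in> T j \<and> v' \<in> T j)))"
              by (intro sum.cong refl sum.mono_neutral_cong_left) (use T_sub[of j] in auto)
            also have "\<dots> = (\<Sum>v\<le>n. \<Sum>v'\<le>n. ?V k j v v' * (c * of_bool (v \<in> T j \<and> v' \<in> T j)))"
              by (intro sum.mono_neutral_left) (use T_sub[of j] in auto)
            finally show ?thesis ..
          qed
          then show "(\<Sum>v\<le>n. \<Sum>v'\<le>n. ?V k j v v' *
              (p\<^sub>\<Theta> k * p\<^sub>\<epsilon> j / (real (card (T j)))\<^sup>2 * of_bool (v \<in> T j \<and> v' \<in> T j)))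
            = p\<^sub>\<Theta> k * p\<^sub>\<epsilon> j / (real (card (T j)))\<^sup>2 * (\<Sum>v\<in>T j. \<Sum>v'\<in>T j. ?V k j v v')"
            unfolding sum_distrib_left by blast
        qed
        also have "\<dots> \<le> (\<Sum>k\<in>{1..M}. \<Sum>j\<in>I. p\<^sub>\<Theta> k * p\<^sub>\<epsilon> j * (potential u s n - 1 / 2))"
        proof (intro sum_mono)
          fix k j assume kj: "k \<in> {1..M}" "j \<in> I"
          have j: "j \<le> Max I" using kj I_finite by simp
          \<comment> \<open>The tip set must be nonempty for its squared size to cancel, since
            division by zero yields zero.\<close>
          have "u \<in> landed s (Suc n - j)" using n j by (intro landed_late[OF valid]) auto
          then have "T j \<noteq> {}" using desc_tip_exists[OF valid, of "Suc n - j" u] by (auto simp: T_def)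
          then have L: "0 < real (card (T j))" by (simp add: T_def card_gt_0_iff)
          have "p\<^sub>\<Theta> k * p\<^sub>\<epsilon> j / (real (card (T j)))\<^sup>2 * (\<Sum>v\<in>T j. \<Sum>v'\<in>T j. ?V k j v v')
            \<le> p\<^sub>\<Theta> k * p\<^sub>\<epsilon> j / (real (card (T j)))\<^sup>2 * ((real (card (T j)))\<^sup>2 * (potential u s n - 1 / 2))"
          proof (rule mult_left_mono)
            show "(\<Sum>v\<in>T j. \<Sum>v'\<in>T j. ?V k j v v') \<le> (real (card (T j)))\<^sup>2 * (potential u s n - 1 / 2)"
              unfolding T_def by (rule potential_drift[OF valid j])
                (use n unfinished in \<open>simp_all add: s_def\<close>)
            show "0 \<le> p\<^sub>\<Theta> k * p\<^sub>\<epsilon> j / (real (card (T j)))\<^sup>2"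
              using p\<^sub>\<Theta>_pos[OF kj(1)] p\<^sub>\<epsilon>_pos[OF kj(2)] by simp
          qed
          also have "\<dots> = p\<^sub>\<Theta> k * p\<^sub>\<epsilon> j * (potential u s n - 1 / 2)" using L by simp
          finally show "p\<^sub>\<Theta> k * p\<^sub>\<epsilon> j / (real (card (T j)))\<^sup>2 * (\<Sum>v\<in>T j. \<Sum>v'\<in>T j. ?V k j v v')
            \<le> p\<^sub>\<Theta> k * p\<^sub>\<epsilon> j * (potential u s n - 1 / 2)" .
        qed
        also have "\<dots> = (\<Sum>k\<in>{1..M}. p\<^sub>\<Theta> k) * (\<Sum>j\<in>I. p\<^sub>\<epsilon> j) * (potential u s n - 1 / 2)"
          by (subst sum_product) (simp only: sum_distrib_right)
        finally show ?thesis using True unfolding p\<^sub>\<Theta>_sum p\<^sub>\<epsilon>_sum by (simp add: s_def)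
      qed
    qed
  qed
  also have "\<dots> = (\<integral>\<omega>. of_bool (pending u (hist \<omega>) n) * potential u (hist \<omega>) n \<partial>P)
      - (\<integral>\<omega>. of_bool (pending u (hist \<omega>) n) / 2 \<partial>P)"
    by (intro Bochner_Integration.integral_diff integrable_potential
          integrable_const_bound[where B = 1]) auto
  also have "(\<integral>\<omega>. of_bool (pending u (hist \<omega>) n) / 2 \<partial>P) = prob {\<omega> \<in> space P. pending u (hist \<omega>) n} / 2"
  proof -
    have "(\<integral>\<omega>. (of_bool (pending u (hist \<omega>) n) :: real) \<partial>P)
      = (\<integral>\<omega>. indicator {\<omega> \<in> space P. pending u (hist \<omega>) n} \<omega> \<partial>P)"
      by (rule Bochner_Integration.integral_cong) (auto simp: indicator_def)
    then show ?thesis by simp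
  qed
  finally show ?thesis .
qed

text \<open>If \<open>B\<close>, the event of never completing a run, had positive probability, the
  expectation \<open>a n\<close> would fall by at least \<open>prob B / 2\<close> at every late step
  and become negative.\<close>

lemma AE_run_goal: "AE \<omega> in P. \<exists>n. run u (hist \<omega>) n = run_goal"
proof -
  define N where "N = u + h M + Max I"
  define B where "B = {\<omega> \<in> space P. \<forall>n. pending u (hist \<omega>) n}"
  define a where "a n = (\<integral>\<omega>. of_bool (pending u (hist \<omega>) n) * potential u (hist \<omega>) n \<partial>P)" for n
  have [measurable]: "B \<in> sets P" unfolding B_def by measurable
  have step: "a (Suc n) \<le> a n - prob B / 2" if "N \<le> n" for n
  proof -
    have "a (Suc n) \<le> (\<integral>\<omega>. of_bool (pending u (hist \<omega>) n) * potential u (hist \<omega>) (Suc n) \<partial>P)"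
      unfolding a_def
    proof (rule integral_mono[OF integrable_potential integrable_potential])
      fix \<omega>
      have "pending u (hist \<omega>) (Suc n) \<Longrightarrow> pending u (hist \<omega>) n" by (auto simp: pending_def)
      then show "of_bool (pending u (hist \<omega>) (Suc n)) * potential u (hist \<omega>) (Suc n)
        \<le> of_bool (pending u (hist \<omega>) n) * potential u (hist \<omega>) (Suc n)"
        by (intro mult_right_mono potential_nonneg) auto
    qed
    also have "\<dots> \<le> a n - prob {\<omega> \<in> space P. pending u (hist \<omega>) n} / 2"
      unfolding a_def using that by (intro expected_drift) (simp add: N_def)
    finally have "a (Suc n) \<le> a n - prob {\<omega> \<in> space P. pending u (hist \<omega>) n} / 2" .
    moreover have "prob B \<le> prob {\<omega> \<in> space P. pending u (hist \<omega>) n}"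
      by (rule finite_measure_mono) (auto simp: B_def)
    ultimately show ?thesis by simp
  qed
  have bound: "a (N + i) \<le> a N - real i * (prob B / 2)" for i
  proof (induction i)
    case (Suc i)
    then show ?case using step[of "N + i"] by (simp add: algebra_simps add_divide_distrib)
  qed simp
  have "prob B = 0"
  proof (rule ccontr)
    assume "prob B \<noteq> 0"
    then have "0 < prob B / 2" by (simp add: zero_less_measure_iff)
    then obtain i where "a N < real i * (prob B / 2)" using reals_Archimedean3 by blast
    moreover have "0 \<le> a (N + i)"
      unfolding a_def by (rule integral_nonneg_AE) (simp add: potential_nonneg)
    ultimately show False using bound[of i] by linarith
  qed
  then have "AE \<omega> in P. \<omega> \<notin> B" by (simp add: prob_eq_0)
  then show ?thesis using AE_space
  proof eventually_elim
    case (elim \<omega>)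
    then obtain n where "run_goal \<le> run u (hist \<omega>) n"
      by (auto simp: B_def pending_def not_less)
    then show ?case using run_attains[of run_goal] by blast
  qed
qed

lemma AE_limit:
  "AE \<omega> in P. limitin dag_metric.mtopology (\<lambda>n. tangle \<Theta> X Y \<omega> (int n)) (tangle_union \<Theta> X Y \<omega>) sequentially
    \<and> one_ended (tangle_union \<Theta> X Y \<omega>)"
proof -
  have "AE \<omega> in P. \<forall>u. \<exists>n. run u (hist \<omega>) n = run_goal"
    unfolding AE_all_countable using AE_run_goal by blast
  with AE_valid show ?thesis
  proof eventually_elim
    case (elim \<omega>)
    show ?case
    proof (rule tangle_limit_one_ended)
      show "valid (hist \<omega>) n" for n using elim(1) by blast
      show "\<exists>a. \<forall>m>a. m \<in> desc (hist \<omega>) u" for u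
        using elim(2) run_goal_imp_desc[of "hist \<omega>" u] elim(1) by blast
    qed (rule hist_def)
  qed
qed

end

theorem theorem3p4:
  fixes P :: "'o measure" and M :: nat and h :: "nat \<Rightarrow> nat" and p\<^sub>\<Theta> :: "nat \<Rightarrow> real"
    and I :: "nat set" and p\<^sub>\<epsilon> :: "nat \<Rightarrow> real" and \<Theta> \<epsilon> X Y :: "nat \<Rightarrow> 'o \<Rightarrow> nat"
  assumes "tangle_model P M h p\<^sub>\<Theta> I p\<^sub>\<epsilon> \<Theta> \<epsilon> X Y"
  shows "AE \<omega> in P. \<exists>G_inf.
    limitin dag_metric.mtopology (\<lambda>n. tangle \<Theta> X Y \<omega> (int n)) G_inf sequentially \<and>
    G_inf = tangle_union \<Theta> X Y \<omega> \<and>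
    one_ended G_inf"
  using tangle_model.AE_limit[OF assms] by auto

end
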